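(* Let $V_4^h$ be the quartic finite element space associated with the element $S_4^h=(T,\mathbb{P}_4(T),\Xi_T)$ on the triangulation $\mathcal{T}_h$, every triangle of which has two type I edges; that is, the space of all $v$ such that $v|_T\in\mathbb{P}_4(T)$ and $v$ is continuous at every degree of freedom in $\Xi_T$, for all $T\in\mathcal{T}_h$. Then there holds the inclusion $V_4^h\subset V$.
   Context: $\Omega\subset\mathbf{R}^2$ is a bounded domain and $\mathcal{T}_h$ is a quasi-uniform triangulation of $\Omega$ such that every triangle has two type I edges. With $\Box v:=\partial_{xx}v-\partial_{yy}v$ (in the sense of distributions), $V:=\{v\in H^1(\Omega):\ \Box v\in L^2(\Omega)\}$. For an edge $e$ with unit normal $n=(n_1,n_2)$ and unit tangent $\tau$, put $\bar n:=(n_1,-n_2)$ and $\partial_{\bar n}v:=\nabla v\cdot\bar n$. The edge $e$ is type I if $\bar n=\pm\tau$ (equivalently, $e$ makes an angle $\pm\pi/4$ with the $x$-axis), and type II otherwise. Let $T$ be a triangle with vertices $a_1,a_2,a_3$; $e_i$ is the edge of $T$ not containing $a_i$, $b_i$ is the midpoint of $e_i$, and $a_{ij\ell}:=\frac13(a_i+a_j+a_\ell)$. Label $T$ so that $e_3$ is its type II edge ($e_1,e_2$ are type I). The element $S_4^h$ has polynomial space $\mathbb{P}_4(T)$ (polynomials of degree at most 4) and degrees of freedom $$\Xi_T:\quad v(a_i)\ (1\le i\le 3);\quad v(a_{ii3}),\,v(a_{i33})\ (1\le i\le 2);\quad v(b_3);\quad v(a_{123});$$ $$\nabla v(a_i)\cdot(a_j-a_i)\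 (1\le i\le 2,\ 1\le j\le 3,\ j\ne i);\quad \partial_{\bar n}v(a_{112}),\ \partial_{\bar n}v(a_{122}),$$ where $\bar n$ is taken with respect to $e_3$. "Continuous at every degree of freedom" means: for each $T$ and each functional in $\Xi_T$, located at a node $p$, the functional (with its fixed direction, if it is a derivative) takes the same value on $v|_{T'}$ for all triangles $T'\in\mathcal{T}_h$ containing $p$. *)

theory Defs
  imports "HOL-Analysis.Analysis"
begin

section \<open>Test functions, weak derivatives, and the space V\<close>

definition pd :: "2 \<Rightarrow> (real^2 \<Rightarrow> real) \<Rightarrow> real^2 \<Rightarrow> real" where
  "pd i f x = frechet_derivative f (at x) (axis i 1)"

definition grad :: "(real^2 \<Rightarrow> real) \<Rightarrow> real^2 \<Rightarrow> real^2" where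
  "grad f x = (\<chi> i. pd i f x)"

definition box_op :: "(real^2 \<Rightarrow> real) \<Rightarrow> real^2 \<Rightarrow> real" where
  "box_op f x = pd 1 (pd 1 f) x - pd 2 (pd 2 f) x"

primrec C_k :: "nat \<Rightarrow> (real^2 \<Rightarrow> real) \<Rightarrow> bool" where
  "C_k 0 f \<longleftrightarrow> continuous_on UNIV f"
| "C_k (Suc k) f \<longleftrightarrow> (\<forall>x. f differentiable (at x)) \<and> (\<forall>i. C_k k (pd i f))"

definition test_functions :: "(real^2) set \<Rightarrow> (real^2 \<Rightarrow> real) set" where
  "test_functions \<Omega> = {\<phi>. (\<forall>k. C_k k \<phi>) \<and>
     compact (closure {x. \<phi> x \<noteq> 0}) \<and> closure {x. \<phi> x \<noteq> 0} \<subseteq> \<Omega>}"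

text \<open>The spaces \<open>L2\<close>, \<open>H1\<close> and \<open>V\<close> consist of functions rather than of classes of functions
  equal almost everywhere. Membership depends only on the values almost everywhere in \<open>\<Omega>\<close>.\<close>

definition L2 :: "(real^2) set \<Rightarrow> (real^2 \<Rightarrow> real) set" where
  "L2 \<Omega> = {f. f \<in> borel_measurable (lebesgue_on \<Omega>) \<and>
     integrable (lebesgue_on \<Omega>) (\<lambda>x. (f x)\<^sup>2)}"

definition has_weak_pd :: "(real^2) set \<Rightarrow> 2 \<Rightarrow> (real^2 \<Rightarrow> real) \<Rightarrow> (real^2 \<Rightarrow> real) \<Rightarrow> bool" where
  "has_weak_pd \<Omega> i v g \<longleftrightarrow> (\<forall>\<phi>\<in>test_functions \<Omega>.
     integral\<^sup>L (lebesgue_on \<Omega>) (\<lambda>x. v x * pd i \<phi> x) = - integral\<^sup>L (lebesgue_on \<Omega>) (\<lambda>x. g x * \<phi> x))"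

definition H1 :: "(real^2) set \<Rightarrow> (real^2 \<Rightarrow> real) set" where
  "H1 \<Omega> = {v \<in> L2 \<Omega>. \<forall>i. \<exists>g\<in>L2 \<Omega>. has_weak_pd \<Omega> i v g}"

text \<open>The distribution \<open>\<partial>\<^sub>x\<^sub>x v - \<partial>\<^sub>y\<^sub>y v\<close> sends a test function \<open>\<phi>\<close> to the integral of
  \<open>v * box_op \<phi>\<close>.\<close>

definition has_weak_box :: "(real^2) set \<Rightarrow> (real^2 \<Rightarrow> real) \<Rightarrow> (real^2 \<Rightarrow> real) \<Rightarrow> bool" where
  "has_weak_box \<Omega> v w \<longleftrightarrow> (\<forall>\<phi>\<in>test_functions \<Omega>.
     integral\<^sup>L (lebesgue_on \<Omega>) (\<lambda>x. v x * box_op \<phi> x) = integral\<^sup>L (lebesgue_on \<Omega>) (\<lambda>x. w x * \<phi> x))"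

definition V :: "(real^2) set \<Rightarrow> (real^2 \<Rightarrow> real) set" where
  "V \<Omega> = {v \<in> H1 \<Omega>. \<exists>w\<in>L2 \<Omega>. has_weak_box \<Omega> v w}"

section \<open>Edges, triangles and triangulations\<close>

text \<open>The edge with end points \<open>p \<noteq> q\<close>. Interchanging \<open>p\<close> and \<open>q\<close> changes the sign of
  tangent and normal, which affects neither the type of the edge nor the continuity of a
  derivative in the direction \<open>bar (edge_normal p q)\<close>.\<close>

definition edge_tangent :: "real^2 \<Rightarrow> real^2 \<Rightarrow> real^2" where
  "edge_tangent p q = sgn (q - p)"

definition edge_normal :: "real^2 \<Rightarrow> real^2 \<Rightarrow> real^2" where
  "edge_normal p q = vector [edge_tangent p q $ 2, - (edge_tangent p q $ 1)]"

definition bar :: "real^2 \<Rightarrow> real^2" where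
  "bar n = vector [n $ 1, - (n $ 2)]"

definition type_I :: "real^2 \<Rightarrow> real^2 \<Rightarrow> bool" where
  "type_I p q \<longleftrightarrow>
     bar (edge_normal p q) = edge_tangent p q \<or> bar (edge_normal p q) = - edge_tangent p q"

text \<open>Vertices are indexed by 1, 2, 3.\<close>

definition triangle_with :: "(real^2) set \<Rightarrow> (nat \<Rightarrow> real^2) \<Rightarrow> bool" where
  "triangle_with T a \<longleftrightarrow> inj_on a {1..3} \<and> \<not> affine_dependent (a ` {1..3}) \<and>
     T = convex hull (a ` {1..3})"

definition two_type_I_edges :: "(real^2) set \<Rightarrow> bool" where
  "two_type_I_edges T \<longleftrightarrow> (\<exists>a. triangle_with T a \<and> type_I (a 2) (a 3) \<and> type_I (a 3) (a 1))"

definition labelled :: "(real^2) set \<Rightarrow> (nat \<Rightarrow> real^2) \<Rightarrow> bool" where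
  "labelled T a \<longleftrightarrow> triangle_with T a \<and>
     type_I (a 2) (a 3) \<and> type_I (a 3) (a 1) \<and> \<not> type_I (a 1) (a 2)"

definition bounded_domain :: "(real^2) set \<Rightarrow> bool" where
  "bounded_domain \<Omega> \<longleftrightarrow> open \<Omega> \<and> connected \<Omega> \<and> \<Omega> \<noteq> {} \<and> bounded \<Omega>"

text \<open>The library predicate \<^const>\<open>triangulation\<close> contains finiteness and conformity: two members
  meet in a common face (possibly empty).\<close>

definition triangulation_of :: "(real^2) set \<Rightarrow> (real^2) set set \<Rightarrow> bool" where
  "triangulation_of \<Omega> \<T> \<longleftrightarrow> triangulation \<T> \<and> (\<forall>T\<in>\<T>. 2 simplex T) \<and> \<Union>\<T> = closure \<Omega>"

text \<open>Quasi-uniformity concerns a family of triangulations indexed by mesh size: the constant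
  \<open>\<sigma>\<close> does not depend on \<open>h\<close>.\<close>

definition quasi_uniform :: "real set \<Rightarrow> (real \<Rightarrow> (real^2) set set) \<Rightarrow> bool" where
  "quasi_uniform H \<T> \<longleftrightarrow> (\<forall>h\<in>H. 0 < h \<and> h = (MAX T\<in>\<T> h. diameter T)) \<and>
     (\<exists>\<sigma>>0. \<forall>h\<in>H. \<forall>T\<in>\<T> h. \<exists>x. ball x (\<sigma> * h) \<subseteq> T)"

section \<open>The quartic finite element space\<close>

definition polys :: "nat \<Rightarrow> (real^2 \<Rightarrow> real) set" where
  "polys k = {p. \<exists>c :: nat \<Rightarrow> nat \<Rightarrow> real.
     \<forall>x. p x = (\<Sum>i\<le>k. \<Sum>j\<le>k - i. c i j * (x $ 1) ^ i * (x $ 2) ^ j)}"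

text \<open>A degree of freedom is a pair of its node and the functional itself.\<close>

type_synonym dof = "(real^2) \<times> ((real^2 \<Rightarrow> real) \<Rightarrow> real)"

definition val_dof :: "real^2 \<Rightarrow> dof" where
  "val_dof x = (x, \<lambda>v. v x)"

definition der_dof :: "real^2 \<Rightarrow> real^2 \<Rightarrow> dof" where
  "der_dof d x = (x, \<lambda>v. grad v x \<bullet> d)"

definition node :: "(nat \<Rightarrow> real^2) \<Rightarrow> nat \<Rightarrow> nat \<Rightarrow> nat \<Rightarrow> real^2" where
  "node a i j l = (1/3) *\<^sub>R (a i + a j + a l)"

definition dofs4 :: "(nat \<Rightarrow> real^2) \<Rightarrow> dof set" where
  "dofs4 a =
     {val_dof (a i) | i. i \<in> {1..3}} \<union>
     {val_dof (node a i i 3) | i. i \<in> {1..2}} \<union>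
     {val_dof (node a i 3 3) | i. i \<in> {1..2}} \<union>
     {val_dof (midpoint (a 1) (a 2)), val_dof (node a 1 2 3)} \<union>
     {der_dof (a j - a i) (a i) | i j. i \<in> {1..2} \<and> j \<in> {1..3} \<and> j \<noteq> i} \<union>
     {der_dof (bar (edge_normal (a 1) (a 2))) (node a 1 1 2),
      der_dof (bar (edge_normal (a 1) (a 2))) (node a 1 2 2)}"

text \<open>A triangle has two labellings, which differ by interchanging \<open>a 1\<close> and \<open>a 2\<close>. They give the
  same functionals up to the sign of the two normal-type derivatives, so taking the union
  over both does not change the continuity conditions.\<close>

definition Xi :: "(real^2) set \<Rightarrow> dof set" where
  "Xi T = \<Union>{dofs4 a | a. labelled T a}"

text \<open>The polynomial \<open>p T\<close> is the restriction of \<open>v\<close> to \<open>T\<close>, up to the boundary. It is only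
  required to agree with \<open>v\<close> in the interior of \<open>T\<close>, since otherwise the mere fact that \<open>v\<close> is
  single-valued on common edges would already force its continuity.\<close>

definition fe_space :: "(real^2) set set \<Rightarrow> (real^2 \<Rightarrow> real) set \<Rightarrow> ((real^2) set \<Rightarrow> dof set)
    \<Rightarrow> (real^2 \<Rightarrow> real) set" where
  "fe_space \<T> P \<Xi> = {v. \<exists>p.
     (\<forall>T\<in>\<T>. p T \<in> P \<and> (\<forall>x\<in>interior T. v x = p T x)) \<and>
     (\<forall>T\<in>\<T>. \<forall>(x, l)\<in>\<Xi> T. \<forall>T'\<in>\<T>. x \<in> T' \<longrightarrow> l (p T') = l (p T))}"

definition V4 :: "(real^2) set set \<Rightarrow> (real^2 \<Rightarrow> real) set" where
  "V4 \<T> = fe_space \<T> (polys 4) Xi"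

end

theory Submission
  imports Defs
begin

text \<open>Let \<open>d = (1, 1)\<close> and \<open>m = (1, -1)\<close>, so that \<open>\<partial>\<^sub>d \<partial>\<^sub>m = \<box>\<close>. A piecewise polynomial may be
  differentiated weakly in a direction \<open>d\<close>, piece by piece, as soon as its values match across
  all edges that are not parallel to \<open>d\<close>. The degrees of freedom on a type II edge determine
  the trace of a quartic and of its whole gradient, those on a type I edge determine the trace.
  Hence \<open>v\<close> itself is continuous, which gives its weak gradient. Moreover \<open>\<partial>\<^sub>m v\<close> matches across
  every edge that is not parallel to \<open>d\<close>: such an edge is of type II, or parallel to \<open>m\<close>, where
  \<open>\<partial>\<^sub>m v\<close> is a tangential derivative. Differentiating once more in direction \<open>d\<close> gives \<open>\<box>v\<close>.\<close>

section \<open>Gradients and polynomials\<close>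

text \<open>Two things obstruct matching: vertices, since the gradient is no degree of freedom at
  \<open>a 3\<close>, and type I edges, across which only the trace is shared while the normal
  derivative may jump. One exceptional set disposes of both. For differentiation in direction
  \<open>d\<close> it is the union of all lines parallel to \<open>d\<close> through vertices: a
  null set, stable under translation along \<open>d\<close>, containing every vertex and every edge
  parallel to \<open>d\<close>. A point off it that lies in two triangles is therefore on a common
  edge that crosses \<open>d\<close>, and not at an end of it. The choice of diagonals as directions
  fits the geometry: \<open>d\<close> and \<open>m\<close> are orthogonal, so the exceptional lines
  for \<open>d\<close> have normal \<open>m\<close>, and a type I edge not contained in them is
  forced to be parallel to \<open>m\<close>. The same vector thus describes the exceptional set and
  the derivative that has to match off it. Each edge is treated from one side only: all nodes needed
  belong to one triangle and lie on the edge, hence in its neighbour too.\<close>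

lemma differentiable_has_derivative_grad:
  assumes "f differentiable (at x)"
  shows "(f has_derivative (\<lambda>h. grad f x \<bullet> h)) (at x)"
proof -
  define f' where "f' = frechet_derivative f (at x)"
  have f': "(f has_derivative f') (at x)"
    using assms unfolding f'_def frechet_derivative_works .
  have lin: "linear f'"
    using f' by (rule has_derivative_linear)
  have "f' h = grad f x \<bullet> h" for h
  proof -
    have "f' h = f' (\<Sum>i\<in>UNIV. h $ i *\<^sub>R axis i 1)"
      using basis_expansion[of h] by (simp add: scalar_mult_eq_scaleR)
    also have "\<dots> = (\<Sum>i\<in>UNIV. h $ i * f' (axis i 1))"
      by (simp add: linear_sum[OF lin] linear_cmul[OF lin])
    also have "\<dots> = grad f x \<bullet> h"
      by (simp add: grad_def pd_def f'_def inner_vec_def mult.commute)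
    finally show ?thesis .
  qed
  then have "f' = (\<lambda>h. grad f x \<bullet> h)" by blast
  with f' show ?thesis by simp
qed

lemma has_derivative_imp_grad_inner:
  assumes "(f has_derivative f') (at x)"
  shows "grad f x \<bullet> d = f' d"
proof -
  have "f differentiable (at x)"
    using assms by (rule differentiableI)
  from has_derivative_unique[OF differentiable_has_derivative_grad[OF this] assms]
  show ?thesis by (rule fun_cong)
qed

lemma has_derivative_imp_pd:
  assumes "(f has_derivative f') (at x)"
  shows "pd i f x = f' (axis i 1)"
  unfolding pd_def using frechet_derivative_at[OF assms] by simp

lemma grad_inner_axis: "grad f x \<bullet> axis i 1 = pd i f x"
  by (simp add: grad_def inner_axis)

lemma grad_inner_2: "grad f x \<bullet> d = pd 1 f x * d $ 1 + pd 2 f x * d $ 2"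
  by (simp add: grad_def inner_vec_def sum_2)

lemma C_k_1_iff: "C_k 1 f \<longleftrightarrow> (\<forall>x. f differentiable (at x)) \<and> (\<forall>i. continuous_on UNIV (pd i f))"
  by simp

lemma C_k_1_has_derivative:
  assumes "C_k 1 f"
  shows "(f has_derivative (\<lambda>h. grad f x \<bullet> h)) (at x)"
  using assms unfolding C_k_1_iff by (blast intro: differentiable_has_derivative_grad)

lemma C_k_1_continuous: "C_k 1 f \<Longrightarrow> continuous_on A f"
  by (intro continuous_at_imp_continuous_on ballI has_derivative_continuous[OF C_k_1_has_derivative])

lemma C_k_1_grad_continuous: "C_k 1 f \<Longrightarrow> continuous_on A (\<lambda>x. grad f x \<bullet> d)"
  unfolding grad_inner_2
  by (intro continuous_intros) (auto simp: C_k_1_iff intro: continuous_on_subset)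

lemma C_k_1I:
  assumes "\<And>x. (f has_derivative (\<lambda>h. G x \<bullet> h)) (at x)" and "continuous_on UNIV G"
  shows "C_k 1 f"
proof -
  have "pd i f = (\<lambda>x. G x \<bullet> axis i 1)" for i
    using has_derivative_imp_pd[OF assms(1)] by blast
  then show ?thesis
    using assms unfolding C_k_1_iff by (auto intro!: continuous_intros differentiableI)
qed

lemma C_k_1_grad_continuous':
  assumes "C_k 1 f" shows "continuous_on A (grad f)"
proof -
  have "continuous_on A (\<lambda>x. \<chi> i. pd i f x)"
    using assms by (intro continuous_on_vec_lambda) (auto simp: C_k_1_iff intro: continuous_on_subset)
  then show ?thesis
    by (simp add: grad_def[abs_def])
qed

lemma C_k_1_mult:
  assumes "C_k 1 f" "C_k 1 g"
  shows "C_k 1 (\<lambda>x. f x * g x)"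
    and "grad (\<lambda>x. f x * g x) x \<bullet> d = f x * (grad g x \<bullet> d) + (grad f x \<bullet> d) * g x"
proof -
  have D: "((\<lambda>x. f x * g x) has_derivative (\<lambda>h. (f x *\<^sub>R grad g x + g x *\<^sub>R grad f x) \<bullet> h)) (at x)" for x
    by (rule has_derivative_eq_rhs[OF has_derivative_mult[OF assms[THEN C_k_1_has_derivative]]])
      (auto simp: inner_left_distrib algebra_simps)
  show "C_k 1 (\<lambda>x. f x * g x)"
    by (rule C_k_1I[OF D]) (intro continuous_intros C_k_1_continuous C_k_1_grad_continuous' assms)
  show "grad (\<lambda>x. f x * g x) x \<bullet> d = f x * (grad g x \<bullet> d) + (grad f x \<bullet> d) * g x"
    using has_derivative_imp_grad_inner[OF D] by (simp add: inner_left_distrib)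
qed

lemma C_k_1_lincomb:
  assumes "C_k 1 f" "C_k 1 g"
  shows "C_k 1 (\<lambda>x. a * f x + b * g x)"
    and "pd i (\<lambda>x. a * f x + b * g x) x = a * pd i f x + b * pd i g x"
proof -
  have D: "((\<lambda>x. a * f x + b * g x) has_derivative (\<lambda>h. (a *\<^sub>R grad f x + b *\<^sub>R grad g x) \<bullet> h)) (at x)" for x
    by (rule has_derivative_eq_rhs[OF has_derivative_add[OF
      assms[THEN C_k_1_has_derivative, THEN has_derivative_mult_right]]])
      (auto simp: inner_left_distrib algebra_simps)
  show "C_k 1 (\<lambda>x. a * f x + b * g x)"
    by (rule C_k_1I[OF D]) (intro continuous_intros C_k_1_continuous C_k_1_grad_continuous' assms)
  show "pd i (\<lambda>x. a * f x + b * g x) x = a * pd i f x + b * pd i g x"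
    using has_derivative_imp_pd[OF D] by (simp add: inner_left_distrib grad_inner_axis)
qed

section \<open>Supports, test functions and global bounds\<close>

lemma grad_zero_outside_support:
  assumes "x \<notin> closure {x. f x \<noteq> 0}"
  shows "grad f x \<bullet> d = 0"
proof -
  have "(f has_derivative (\<lambda>h. 0)) (at x)"
  proof (rule has_derivative_transform_within_open[where f = "\<lambda>_. 0"])
    show "0 = f y" if "y \<in> - closure {x. f x \<noteq> 0}" for y
      using that closure_subset[of "{x. f x \<noteq> 0}"] by auto
  qed (use assms in auto)
  then show ?thesis
    by (rule has_derivative_imp_grad_inner)
qed

lemma test_functions_pd:
  assumes "\<phi> \<in> test_functions \<Omega>"
  shows "pd i \<phi> \<in> test_functions \<Omega>"
proof -
  have sub: "closure {x. pd i \<phi> x \<noteq> 0} \<subseteq> closure {x. \<phi> x \<noteq> 0}"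
    using grad_zero_outside_support[of _ \<phi> "axis i 1"]
    by (intro closure_minimal) (auto simp: grad_inner_axis)
  moreover have "C_k k (pd i \<phi>)" for k
  proof -
    have "C_k (Suc k) \<phi>" using assms unfolding test_functions_def by blast
    then show ?thesis by simp
  qed
  moreover have "compact (closure {x. pd i \<phi> x \<noteq> 0})"
    using assms sub unfolding test_functions_def
    by (auto intro: compact_closure[THEN iffD2] dest: compact_imp_bounded bounded_subset[OF _ closure_subset]
       intro: bounded_subset[OF _ order.trans[OF closure_subset sub]])
  ultimately show ?thesis
    using assms unfolding test_functions_def by auto
qed

lemma bounded_support_bounded:
  fixes f :: "real^2 \<Rightarrow> real"
  assumes "continuous_on UNIV f" "bounded {x. f x \<noteq> 0}"
  obtains B where "0 \<le> B" "\<And>x. \<bar>f x\<bar> \<le> B"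
proof -
  have "compact (closure {x. f x \<noteq> 0})"
    using assms(2) by (simp add: compact_closure)
  then have "bounded (f ` closure {x. f x \<noteq> 0})"
    by (intro compact_imp_bounded compact_continuous_image continuous_on_subset[OF assms(1) subset_UNIV])
  then obtain B where B: "\<And>x. x \<in> closure {x. f x \<noteq> 0} \<Longrightarrow> \<bar>f x\<bar> \<le> B"
    unfolding bounded_real by (auto simp: ball_simps)
  have "\<bar>f x\<bar> \<le> max 0 B" for x
  proof (cases "f x = 0")
    case False
    then have "x \<in> closure {x. f x \<noteq> 0}" by (intro subsetD[OF closure_subset]) simp
    from B[OF this] show ?thesis by (rule max.coboundedI2)
  next
    case True
    then show ?thesis by (simp only: abs_zero max.cobounded1)
  qed
  then show thesis by (rule that[OF max.cobounded1])
qed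

text \<open>Supplies the constant that dominates the difference quotients in the integration by
  parts. The partial derivatives are continuous with bounded support, hence bounded, and the mean
  value inequality holds on the whole plane.\<close>

lemma C_k_1_lipschitz:
  assumes f: "C_k 1 f" and "bounded {x. f x \<noteq> 0}"
  obtains L where "0 \<le> L" "\<And>x y. \<bar>f x - f y\<bar> \<le> L * norm (x - y)"
proof -
  have b: "bounded {x. pd i f x \<noteq> 0}" for i
  proof (rule bounded_subset)
    show "bounded (closure {x. f x \<noteq> 0})" using assms by auto
    show "{x. pd i f x \<noteq> 0} \<subseteq> closure {x. f x \<noteq> 0}"
      using grad_zero_outside_support[of _ f "axis i 1"] by (auto simp: grad_inner_axis)
  qed
  have "\<exists>B. 0 \<le> B \<and> (\<forall>x. \<bar>pd i f x\<bar> \<le> B)" for i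
    by (rule bounded_support_bounded[OF _ b[of i]]) (use f in \<open>auto simp: C_k_1_iff\<close>)
  then obtain B where B: "\<And>i. 0 \<le> B i" "\<And>i x. \<bar>pd i f x\<bar> \<le> B i"
    by (metis (no_types))
  have "norm (f x - f y) \<le> (B 1 + B 2) * norm (x - y)" for x y
  proof (rule differentiable_bound[of UNIV _ "\<lambda>x h. grad f x \<bullet> h"])
    show "onorm (\<lambda>h. grad f x \<bullet> h) \<le> B 1 + B 2" for x
    proof (rule onorm_bound)
      show "norm (grad f x \<bullet> h) \<le> (B 1 + B 2) * norm h" for h
      proof -
        have "\<bar>grad f x \<bullet> h\<bar> \<le> \<bar>pd 1 f x * h $ 1\<bar> + \<bar>pd 2 f x * h $ 2\<bar>"
          unfolding grad_inner_2 by (rule abs_triangle_ineq)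
        also have "\<dots> \<le> B 1 * norm h + B 2 * norm h"
          unfolding abs_mult by (intro add_mono mult_mono B component_le_norm_cart) auto
        finally show ?thesis by (simp add: algebra_simps)
      qed
    qed (use B in auto)
  qed (use C_k_1_has_derivative[OF f] in auto)
  then have "\<bar>f x - f y\<bar> \<le> (B 1 + B 2) * norm (x - y)" for x y by simp
  then show thesis by (rule that[rotated]) (simp add: B)
qed

section \<open>Polynomials of bounded degree in two variables\<close>

lemma polys_add: "p \<in> polys k \<Longrightarrow> q \<in> polys k \<Longrightarrow> (\<lambda>x. p x + q x) \<in> polys k"
  unfolding polys_def mem_Collect_eq
proof (elim exE)
  fix c d assume "\<forall>x. p x = (\<Sum>i\<le>k. \<Sum>j\<le>k - i. c i j * (x $ 1) ^ i * (x $ 2) ^ j)"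
    "\<forall>x. q x = (\<Sum>i\<le>k. \<Sum>j\<le>k - i. d i j * (x $ 1) ^ i * (x $ 2) ^ j)"
  then show "\<exists>c. \<forall>x. p x + q x = (\<Sum>i\<le>k. \<Sum>j\<le>k - i. c i j * (x $ 1) ^ i * (x $ 2) ^ j)"
    by (intro exI[of _ "\<lambda>i j. c i j + d i j"]) (simp add: sum.distrib distrib_right)
qed

lemma polys_cmult: "p \<in> polys k \<Longrightarrow> (\<lambda>x. a * p x) \<in> polys k"
  unfolding polys_def mem_Collect_eq
proof (elim exE)
  fix c assume "\<forall>x. p x = (\<Sum>i\<le>k. \<Sum>j\<le>k - i. c i j * (x $ 1) ^ i * (x $ 2) ^ j)"
  then show "\<exists>c. \<forall>x. a * p x = (\<Sum>i\<le>k. \<Sum>j\<le>k - i. c i j * (x $ 1) ^ i * (x $ 2) ^ j)"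
    by (intro exI[of _ "\<lambda>i j. a * c i j"]) (simp add: sum_distrib_left mult.assoc)
qed

text \<open>Together with sums and scalar multiples this replaces any reindexing of the defining
  double sum: a derivative is seen to be a polynomial monomial by monomial.\<close>

lemma polys_monomial:
  assumes "m + n \<le> k"
  shows "(\<lambda>x. (x $ 1) ^ m * (x $ 2) ^ n) \<in> polys k"
proof -
  have "(x $ 1) ^ m * (x $ 2) ^ n
      = (\<Sum>i\<le>k. \<Sum>j\<le>k - i. (if i = m \<and> j = n then 1 else 0) * (x $ 1) ^ i * (x $ 2) ^ j)" for x :: "real^2"
  proof -
    have "(\<Sum>i\<le>k. \<Sum>j\<le>k - i. (if i = m \<and> j = n then 1 else 0) * (x $ 1) ^ i * (x $ 2) ^ j)
      = (\<Sum>i\<le>k. if i = m then (x $ 1) ^ m * (x $ 2) ^ n else 0)"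
    proof (rule sum.cong[OF refl])
      fix i assume "i \<in> {..k}"
      show "(\<Sum>j\<le>k - i. (if i = m \<and> j = n then 1 else 0) * (x $ 1) ^ i * (x $ 2) ^ j)
        = (if i = m then (x $ 1) ^ m * (x $ 2) ^ n else 0)"
      proof (cases "i = m")
        case True
        then have "(\<Sum>j\<le>k - i. (if i = m \<and> j = n then 1 else 0) * (x $ 1) ^ i * (x $ 2) ^ j)
          = (\<Sum>j\<le>k - m. if j = n then (x $ 1) ^ m * (x $ 2) ^ n else 0)"
          by (intro sum.cong) auto
        then show ?thesis using True assms by simp
      qed simp
    qed
    then show ?thesis using assms by simp
  qed
  then show ?thesis
    unfolding polys_def mem_Collect_eq by (intro exI[of _ "\<lambda>i j. if i = m \<and> j = n then 1 else 0"]) blast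
qed

lemma polys_zero: "(\<lambda>x. 0) \<in> polys k"
  using polys_cmult[OF polys_monomial[of 0 0 k], of 0] by simp

lemma polys_sum:
  "(\<And>i. i \<in> I \<Longrightarrow> f i \<in> polys k) \<Longrightarrow> (\<lambda>x. \<Sum>i\<in>I. f i x) \<in> polys k"
  by (induction I rule: infinite_finite_induct) (auto intro: polys_zero polys_add)

lemma polys_has_derivative:
  assumes "p \<in> polys (Suc k)"
  obtains p1 p2 where "p1 \<in> polys k" "p2 \<in> polys k"
    "\<And>x. (p has_derivative (\<lambda>h. p1 x * h $ 1 + p2 x * h $ 2)) (at x)"
proof -
  obtain c where c: "\<And>x. p x = (\<Sum>i\<le>Suc k. \<Sum>j\<le>Suc k - i. c i j * (x $ 1) ^ i * (x $ 2) ^ j)"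
    using assms unfolding polys_def by blast
  \<comment> \<open>For \<open>i = 0\<close> the exponent \<open>i - 1\<close> truncates to 0, but
    the factor \<open>of_nat i\<close> removes the term; likewise for \<open>j\<close> in
    \<open>q2\<close>.\<close>
  define q1 where "q1 i j x = c i j * of_nat i * ((x $ 1) ^ (i - 1) * (x $ 2) ^ j)" for i j and x :: "real^2"
  define q2 where "q2 i j x = c i j * of_nat j * ((x $ 1) ^ i * (x $ 2) ^ (j - 1))" for i j and x :: "real^2"
  define p1 where "p1 x = (\<Sum>i\<le>Suc k. \<Sum>j\<le>Suc k - i. q1 i j x)" for x
  define p2 where "p2 x = (\<Sum>i\<le>Suc k. \<Sum>j\<le>Suc k - i. q2 i j x)" for x
  have q: "q1 i j \<in> polys k" "q2 i j \<in> polys k" if "i \<le> Suc k" "j \<le> Suc k - i" for i j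
  proof -
    show "q1 i j \<in> polys k"
    proof (cases i)
      case 0 then show ?thesis using polys_zero by (simp add: q1_def[abs_def])
    next
      case (Suc m)
      then show ?thesis unfolding q1_def[abs_def] using that
        by (intro polys_cmult polys_monomial) auto
    qed
    show "q2 i j \<in> polys k"
    proof (cases j)
      case 0 then show ?thesis using polys_zero by (simp add: q2_def[abs_def])
    next
      case (Suc m)
      then show ?thesis unfolding q2_def[abs_def] using that
        by (intro polys_cmult polys_monomial) auto
    qed
  qed
  have "p1 \<in> polys k" "p2 \<in> polys k"
    unfolding p1_def[abs_def] p2_def[abs_def] by (intro polys_sum q; simp)+
  moreover have "(p has_derivative (\<lambda>h. p1 x * h $ 1 + p2 x * h $ 2)) (at x)" for x
  proof -
    have "((\<lambda>x. \<Sum>i\<le>Suc k. \<Sum>j\<le>Suc k - i. c i j * (x $ 1) ^ i * (x $ 2) ^ j) has_derivative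
      (\<lambda>h. \<Sum>i\<le>Suc k. \<Sum>j\<le>Suc k - i. q1 i j x * h $ 1 + q2 i j x * h $ 2)) (at x)"
      unfolding q1_def q2_def
      by (intro has_derivative_sum)
        (auto intro!: derivative_eq_intros bounded_linear_imp_has_derivative bounded_linear_vec_nth
          simp: algebra_simps)
    then show ?thesis
      unfolding p1_def p2_def c[abs_def]
      by (simp only: sum.distrib sum_distrib_right)
  qed
  ultimately show thesis using that by blast
qed

lemma polys_mono:
  assumes "p \<in> polys k" "k \<le> l"
  shows "p \<in> polys l"
proof -
  obtain c where c: "\<And>x. p x = (\<Sum>i\<le>k. \<Sum>j\<le>k - i. c i j * (x $ 1) ^ i * (x $ 2) ^ j)"
    using assms unfolding polys_def by blast
  show ?thesis
    unfolding c[abs_def] mult.assoc using assms(2)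
    by (intro polys_sum polys_cmult polys_monomial) auto
qed

lemma polys_continuous: "p \<in> polys k \<Longrightarrow> continuous_on A p"
proof -
  assume "p \<in> polys k"
  then obtain c where c: "\<And>x. p x = (\<Sum>i\<le>k. \<Sum>j\<le>k - i. c i j * (x $ 1) ^ i * (x $ 2) ^ j)"
    unfolding polys_def by blast
  show ?thesis unfolding c[abs_def] by (intro continuous_intros)
qed

lemma polys_C_k_1:
  assumes "p \<in> polys k"
  shows "C_k 1 p"
proof -
  have "p \<in> polys (Suc k)" using assms by (rule polys_mono) simp
  then obtain p1 p2 where p: "p1 \<in> polys k" "p2 \<in> polys k"
    and D: "\<And>x. (p has_derivative (\<lambda>h. p1 x * h $ 1 + p2 x * h $ 2)) (at x)"
    by (rule polys_has_derivative[of p k]) blast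
  have "pd i p = (\<lambda>x. p1 x * axis i 1 $ 1 + p2 x * axis i 1 $ 2)" for i
    using has_derivative_imp_pd[OF D] by blast
  then show ?thesis
    unfolding C_k_1_iff using D p by (auto intro!: continuous_intros differentiableI intro: polys_continuous[OF p(1)] polys_continuous[OF p(2)])
qed

lemma polys_grad:
  assumes "p \<in> polys (Suc k)"
  shows "(\<lambda>x. grad p x \<bullet> d) \<in> polys k"
proof -
  obtain p1 p2 where p: "p1 \<in> polys k" "p2 \<in> polys k"
    and D: "\<And>x. (p has_derivative (\<lambda>h. p1 x * h $ 1 + p2 x * h $ 2)) (at x)"
    using assms by (rule polys_has_derivative[of p k]) blast
  show ?thesis
    unfolding has_derivative_imp_grad_inner[OF D]
    using polys_add[OF polys_cmult[OF p(1), of "d$1"] polys_cmult[OF p(2), of "d$2"]]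
    by (simp add: mult.commute)
qed

text \<open>Reduces questions on an edge to one variable, by substituting a polynomial of degree at
  most one in the line parameter for each coordinate.\<close>

lemma polys_on_line:
  assumes "p \<in> polys k"
  obtains r :: "real poly" where "degree r \<le> k" "\<And>t. p (a + t *\<^sub>R e) = poly r t"
proof -
  obtain c where c: "\<And>x. p x = (\<Sum>i\<le>k. \<Sum>j\<le>k - i. c i j * (x $ 1) ^ i * (x $ 2) ^ j)"
    using assms unfolding polys_def by blast
  define r where "r = (\<Sum>i\<le>k. \<Sum>j\<le>k - i. [:c i j:] * [:a $ 1, e $ 1:] ^ i * [:a $ 2, e $ 2:] ^ j)"
  have deg: "degree ([:c i j:] * [:a $ 1, e $ 1:] ^ i * [:a $ 2, e $ 2:] ^ j) \<le> k"
    if "i \<le> k" "j \<le> k - i" for i j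
  proof -
    have "degree ([:c i j:] * [:a $ 1, e $ 1:] ^ i * [:a $ 2, e $ 2:] ^ j) \<le> 0 + i + j"
      by (intro order.trans[OF degree_mult_le] add_mono order.trans[OF degree_power_le]) auto
    then show ?thesis using that by simp
  qed
  have "degree r \<le> k"
    unfolding r_def by (intro degree_sum_le finite_atMost deg) auto
  moreover have "p (a + t *\<^sub>R e) = poly r t" for t
    by (simp add: c r_def poly_sum mult.assoc)
  ultimately show thesis using that by blast
qed

section \<open>Integration by parts for piecewise smooth functions\<close>

lemma AE_lborel_negligible:
  assumes "negligible N"
  shows "AE x in lborel. x \<notin> N"
proof -
  have "AE x in lebesgue. x \<notin> N"
    using assms by (intro AE_not_in) (simp add: negligible_iff_null_sets)
  then show ?thesis by (simp add: AE_completion_iff)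
qed

text \<open>Both end points of a difference quotient have to avoid the exceptional set.\<close>

lemma AE_lborel_negligible_translate:
  fixes N :: "'a::euclidean_space set"
  assumes "negligible N"
  shows "AE x in lborel. x + c \<notin> N"
proof -
  have "AE x in lborel. x \<notin> (+) (- c) ` N"
    by (intro AE_lborel_negligible negligible_translation assms)
  then show ?thesis
    by eventually_elim (force simp: image_iff)
qed

text \<open>Only comparisons with the centre \<open>s\<close> are assumed: near a point where
  several triangles meet, each neighbour in the mesh shares a triangle with the centre, but two
  neighbours need not share one. A short interval is split at the centre, and Bolzano's bisection
  principle joins short intervals.\<close>

lemma lipschitz_from_local:
  fixes f :: "real \<Rightarrow> real"
  assumes "a \<le> b"
    and local: "\<And>s. \<exists>\<delta>>0. \<forall>r. \<bar>r - s\<bar> < \<delta> \<longrightarrow> \<bar>f r - f s\<bar> \<le> L * \<bar>r - s\<bar>"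
  shows "\<bar>f b - f a\<bar> \<le> L * (b - a)"
  using assms(1)
proof (induction rule: Bolzano)
  case (trans a b c)
  then show ?case by (simp add: algebra_simps)
next
  case (local x)
  obtain \<delta> where "\<delta> > 0" and \<delta>: "\<And>r. \<bar>r - x\<bar> < \<delta> \<Longrightarrow> \<bar>f r - f x\<bar> \<le> L * \<bar>r - x\<bar>"
    using assms(2)[of x] by blast
  have "\<bar>f b - f a\<bar> \<le> L * (b - a)" if "a \<le> x" "x \<le> b" "b - a < \<delta>" for a b
    using \<delta>[of a] \<delta>[of b] that by (simp add: algebra_simps)
  with \<open>\<delta> > 0\<close> show ?case by blast
qed

lemma lborel_integral_translation:
  fixes f :: "'a::euclidean_space \<Rightarrow> real"
  assumes "integrable lborel f"
  shows "integrable lborel (\<lambda>x. f (c + x))"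
    and "(\<integral>x. f (c + x) \<partial>lborel) = (\<integral>x. f x \<partial>lborel)"
proof -
  have m: "(+) c \<in> measurable lborel borel" and f: "f \<in> borel_measurable borel"
    using assms by auto
  show "integrable lborel (\<lambda>x. f (c + x))"
    using integrable_distr_eq[OF m f] assms by (simp add: lborel_distr_plus)
  show "(\<integral>x. f (c + x) \<partial>lborel) = (\<integral>x. f x \<partial>lborel)"
    using integral_distr[OF m f] by (simp add: lborel_distr_plus)
qed

text \<open>Interiors are used so that at most one term is nonzero in a mesh. The value 0 on
  frontiers is a default on a null set; in return measurability and linearity in the pieces are
  immediate.\<close>

definition pw :: "(real^2) set set \<Rightarrow> ((real^2) set \<Rightarrow> real^2 \<Rightarrow> real) \<Rightarrow> real^2 \<Rightarrow> real" where
  "pw \<T> Q x = (\<Sum>T\<in>\<T>. indicator (interior T) x * Q T x)"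

text \<open>The facts about a triangulation on which the measure theory rests: convexity makes the
  frontiers null sets, and disjoint interiors make \<open>pw\<close> take the intended
  values.\<close>

locale mesh =
  fixes \<T> :: "(real^2) set set"
  assumes fin: "finite \<T>"
    and compact: "\<And>T. T \<in> \<T> \<Longrightarrow> compact T"
    and convex: "\<And>T. T \<in> \<T> \<Longrightarrow> convex T"
    and disjoint: "\<And>T T'. T \<in> \<T> \<Longrightarrow> T' \<in> \<T> \<Longrightarrow> T \<noteq> T' \<Longrightarrow> interior T \<inter> interior T' = {}"
begin

section \<open>Piecewise functions on a mesh\<close>

lemma closed_Union: "closed (\<Union>\<T>)"
  using fin compact by (intro Topological_Spaces.closed_Union) (auto intro: compact_imp_closed)

lemma negligible_frontiers: "negligible (\<Union>T\<in>\<T>. frontier T)"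
  using fin convex by (intro negligible_Union) (auto intro: negligible_convex_frontier)

lemma in_interior: "T \<in> \<T> \<Longrightarrow> x \<in> T \<Longrightarrow> x \<notin> (\<Union>T\<in>\<T>. frontier T) \<Longrightarrow> x \<in> interior T"
  by (auto simp: frontier_def closure_closed[OF compact_imp_closed[OF compact]])

lemma pw_interior:
  assumes "T \<in> \<T>" "x \<in> interior T"
  shows "pw \<T> Q x = Q T x"
proof -
  have "pw \<T> Q x = (\<Sum>T'\<in>\<T>. if T' = T then Q T x else 0)"
    unfolding pw_def using disjoint[OF assms(1)] assms(2)
    by (intro sum.cong) (auto simp: indicator_def)
  then show ?thesis using assms fin by simp
qed

lemma pw_outside:
  assumes "x \<notin> \<Union>\<T>"
  shows "pw \<T> Q x = 0"
  unfolding pw_def using assms interior_subset by (intro sum.neutral) (auto simp: indicator_def)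

lemma pw_mult: "pw \<T> (\<lambda>T x. Q T x * h x) x = pw \<T> Q x * h x"
  by (simp add: pw_def sum_distrib_right mult.assoc)

lemma pw_add: "pw \<T> (\<lambda>T x. Q T x + R T x) x = pw \<T> Q x + pw \<T> R x"
  by (simp add: pw_def sum.distrib distrib_left)

lemma pw_cmult: "pw \<T> (\<lambda>T x. a * Q T x) x = a * pw \<T> Q x"
  by (simp add: pw_def sum_distrib_left mult.left_commute)

lemma pw_measurable:
  assumes "\<And>T. T \<in> \<T> \<Longrightarrow> continuous_on UNIV (Q T)"
  shows "pw \<T> Q \<in> borel_measurable borel"
  unfolding pw_def[abs_def] using assms
  by (intro borel_measurable_sum borel_measurable_times borel_measurable_indicator
      borel_measurable_continuous_onI) auto

lemma pw_integrable:
  assumes "\<And>T. T \<in> \<T> \<Longrightarrow> continuous_on UNIV (Q T)"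
  shows "integrable lborel (pw \<T> Q)"
  unfolding pw_def[abs_def]
proof (rule Bochner_Integration.integrable_sum)
  fix T assume T: "T \<in> \<T>"
  have "integrable lborel (\<lambda>x. indicator T x *\<^sub>R Q T x)"
    by (intro borel_integrable_compact compact[OF T] continuous_on_subset[OF assms[OF T]]) auto
  then have "integrable lborel (\<lambda>x. indicator (interior T) x *\<^sub>R (indicator T x *\<^sub>R Q T x))"
    by (rule integrable_mult_indicator[rotated]) simp
  moreover have "indicator (interior T) x *\<^sub>R (indicator T x *\<^sub>R Q T x) = indicator (interior T) x * Q T x" for x
    using interior_subset[of T] by (auto simp: indicator_def)
  ultimately show "integrable lborel (\<lambda>x. indicator (interior T) x * Q T x)"
    by (simp only:)
qed

lemma pw_mult_integrable:
  assumes "\<And>T. T \<in> \<T> \<Longrightarrow> continuous_on UNIV (Q T)" "continuous_on UNIV h"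
  shows "integrable lborel (\<lambda>x. pw \<T> Q x * h x)"
proof -
  have "integrable lborel (pw \<T> (\<lambda>T x. Q T x * h x))"
    using assms by (intro pw_integrable continuous_on_mult)
  then show ?thesis
    by (simp only: pw_mult[abs_def])
qed

text \<open>The finitely many members avoiding \<open>z\<close> have a closed union, so a ball
  around \<open>z\<close> misses it. Hence nearby points of the mesh always share a member with
  \<open>z\<close>.\<close>

lemma locally_only_containing:
  obtains \<delta> where "\<delta> > 0" "\<And>T y. T \<in> \<T> \<Longrightarrow> y \<in> T \<Longrightarrow> dist z y < \<delta> \<Longrightarrow> z \<in> T"
proof -
  have "closed (\<Union>{T \<in> \<T>. z \<notin> T})"
    using fin compact by (intro Topological_Spaces.closed_Union) (auto intro: compact_imp_closed)
  then have "open (- \<Union>{T \<in> \<T>. z \<notin> T})" "z \<in> - \<Union>{T \<in> \<T>. z \<notin> T}"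
    by (auto simp: open_Compl)
  then obtain \<delta> where \<delta>: "\<delta> > 0" "ball z \<delta> \<subseteq> - \<Union>{T \<in> \<T>. z \<notin> T}"
    by (rule openE)
  have "z \<in> T" if "T \<in> \<T>" "y \<in> T" "dist z y < \<delta>" for T y
    using that \<delta>(2) mem_ball[of y z \<delta>] by blast
  with \<delta>(1) show thesis by (rule that)
qed

text \<open>Neither Fubini nor boundary integrals are needed: off \<open>N\<close> the product of the piecewise
  function with \<open>\<phi>\<close> is Lipschitz along the lines in direction \<open>d\<close>, its difference quotients have
  integral zero by translation invariance, and dominated convergence applies.\<close>

lemma integral_by_parts:
  assumes P: "\<And>T. T \<in> \<T> \<Longrightarrow> C_k 1 (P T)"
    and N: "negligible N" "\<And>z t. z \<notin> N \<Longrightarrow> z + t *\<^sub>R d \<notin> N"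
    and matching: "\<And>T T' z. T \<in> \<T> \<Longrightarrow> T' \<in> \<T> \<Longrightarrow> z \<in> T \<Longrightarrow> z \<in> T' \<Longrightarrow> z \<notin> N \<Longrightarrow> P T z = P T' z"
    and \<phi>: "C_k 1 \<phi>" "bounded {x. \<phi> x \<noteq> 0}" "\<And>x. x \<notin> \<Union>\<T> \<Longrightarrow> \<phi> x = 0"
  shows "(\<integral>x. pw \<T> P x * (grad \<phi> x \<bullet> d) \<partial>lborel)
    = - (\<integral>x. pw \<T> (\<lambda>T x. grad (P T) x \<bullet> d) x * \<phi> x \<partial>lborel)"
proof -
  define Q where "Q T x = P T x * \<phi> x" for T x
  \<comment> \<open>Two versions of the same product: \<open>W\<close> has meaningful values on
    edges too and can be followed along a line across them, \<open>u\<close> is visibly measurable.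
    By matching, the choice in \<open>W\<close> does not matter off \<open>N\<close>, and the two
    versions agree off \<open>F\<close>.\<close>
  define W where "W z = (if z \<in> \<Union>\<T> then Q (SOME T. T \<in> \<T> \<and> z \<in> T) z else 0)" for z
  define G where "G T x = grad (Q T) x \<bullet> d" for T x
  define F where "F = N \<union> (\<Union>T\<in>\<T>. frontier T)"
  define u where "u = pw \<T> Q"
  have Q: "C_k 1 (Q T)" if "T \<in> \<T>" for T
    using C_k_1_mult(1)[OF P[OF that] \<phi>(1)] by (simp add: Q_def[abs_def])
  have G: "G T x = P T x * (grad \<phi> x \<bullet> d) + (grad (P T) x \<bullet> d) * \<phi> x" if "T \<in> \<T>" for T x
    using C_k_1_mult(2)[OF P[OF that] \<phi>(1)] by (simp add: G_def Q_def[abs_def])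
  have Q_bounded: "bounded {x. Q T x \<noteq> 0}" for T
    by (rule bounded_subset[OF \<phi>(2)]) (auto simp: Q_def)
  have "\<exists>L. 0 \<le> L \<and> (\<forall>x y. \<bar>Q T x - Q T y\<bar> \<le> L * norm (x - y))" if "T \<in> \<T>" for T
    by (rule C_k_1_lipschitz[OF Q[OF that] Q_bounded[of T]]) blast
  then obtain L where L: "\<And>T. T \<in> \<T> \<Longrightarrow> 0 \<le> L T"
    "\<And>T x y. T \<in> \<T> \<Longrightarrow> \<bar>Q T x - Q T y\<bar> \<le> L T * norm (x - y)"
    by metis
  \<comment> \<open>The sum bounds every \<open>L T\<close> at once; \<open>norm d\<close> converts
    distances into differences of the line parameter.\<close>
  define M where "M = (\<Sum>T\<in>\<T>. L T) * norm d"
  have M: "0 \<le> M" unfolding M_def using L by (intro mult_nonneg_nonneg sum_nonneg) auto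
  have Q_lip: "\<bar>Q T (z + r *\<^sub>R d) - Q T (z + s *\<^sub>R d)\<bar> \<le> M * \<bar>r - s\<bar>" if T: "T \<in> \<T>" for T z r s
  proof -
    have "\<bar>Q T (z + r *\<^sub>R d) - Q T (z + s *\<^sub>R d)\<bar> \<le> L T * norm ((r - s) *\<^sub>R d)"
      using L(2)[OF T, of "z + r *\<^sub>R d" "z + s *\<^sub>R d"] by (simp add: scaleR_left_diff_distrib)
    also have "\<dots> \<le> (\<Sum>T\<in>\<T>. L T) * norm ((r - s) *\<^sub>R d)"
      using fin T L(1) by (intro mult_right_mono member_le_sum) auto
    finally show ?thesis by (simp add: M_def mult_ac)
  qed
  have W_eq: "W z = Q T z" if "T \<in> \<T>" "z \<in> T" "z \<notin> N" for T z
  proof -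
    define T' where "T' = (SOME T. T \<in> \<T> \<and> z \<in> T)"
    have "T' \<in> \<T> \<and> z \<in> T'" unfolding T'_def using that by (intro someI) auto
    then have "P T' z = P T z" using matching that by blast
    moreover have "W z = Q T' z" unfolding W_def T'_def using that by auto
    ultimately show ?thesis by (simp add: Q_def)
  qed
  have outside: "W z = 0" "Q T z = 0" if "z \<notin> \<Union>\<T>" for z T
    using that \<phi>(3) by (auto simp: W_def Q_def)
  have W_lip: "\<bar>W (z + t *\<^sub>R d) - W z\<bar> \<le> M * t" if z: "z \<notin> N" and t: "0 \<le> t" for z t
  proof -
    have "\<bar>W (z + t *\<^sub>R d) - W (z + 0 *\<^sub>R d)\<bar> \<le> M * (t - 0)"
    proof (rule lipschitz_from_local[OF t])
      fix s
      define z' where "z' = z + s *\<^sub>R d"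
      obtain \<delta> where \<delta>: "\<delta> > 0" "\<And>T y. T \<in> \<T> \<Longrightarrow> y \<in> T \<Longrightarrow> dist z' y < \<delta> \<Longrightarrow> z' \<in> T"
        using locally_only_containing[of z'] by metis
      have nN: "z + r *\<^sub>R d \<notin> N" for r using N(2)[OF z] .
      \<comment> \<open>The \<open>+ 1\<close> in the radius keeps the quotient positive also for
        \<open>d = 0\<close>.\<close>
      have "\<bar>W (z + r *\<^sub>R d) - W (z + s *\<^sub>R d)\<bar> \<le> M * \<bar>r - s\<bar>"
        if r: "\<bar>r - s\<bar> < \<delta> / (norm d + 1)" for r
      proof -
        have "dist z' (z + r *\<^sub>R d) = \<bar>r - s\<bar> * norm d"
          unfolding z'_def dist_norm
          by (metis abs_minus_commute add_diff_cancel_left norm_scaleR scaleR_left_diff_distrib)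
        also have "\<dots> \<le> \<bar>r - s\<bar> * (norm d + 1)" by (intro mult_left_mono) auto
        also have "\<dots> < \<delta>" using r by (simp add: pos_less_divide_eq add_nonneg_pos)
        finally have dist: "dist z' (z + r *\<^sub>R d) < \<delta>" .
        show ?thesis
        proof (cases "\<exists>T\<in>\<T>. z + r *\<^sub>R d \<in> T")
          case True
          then obtain T where T: "T \<in> \<T>" "z + r *\<^sub>R d \<in> T" by blast
          then have "z + s *\<^sub>R d \<in> T" using \<delta>(2) dist z'_def by blast
          then show ?thesis using W_eq[OF T nN] W_eq[OF T(1) _ nN] Q_lip[OF T(1)] by simp
        next
          case out: False
          show ?thesis
          proof (cases "\<exists>T\<in>\<T>. z + s *\<^sub>R d \<in> T")
            case True
            then obtain T where T: "T \<in> \<T>" "z + s *\<^sub>R d \<in> T" by blast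
            \<comment> \<open>Outside the mesh \<open>\<phi>\<close> vanishes, and with it
              \<open>Q T\<close>, so the Lipschitz bound of \<open>Q T\<close> also covers the
              crossing of the outer boundary.\<close>
            have "W (z + r *\<^sub>R d) = Q T (z + r *\<^sub>R d)" using out outside by auto
            then show ?thesis using W_eq[OF T nN] Q_lip[OF T(1)] by simp
          next
            case False
            then show ?thesis using out outside M by auto
          qed
        qed
      qed
      moreover have "\<delta> / (norm d + 1) > 0" using \<delta>(1) by (simp add: add_nonneg_pos)
      ultimately show "\<exists>\<delta>>0. \<forall>r. \<bar>r - s\<bar> < \<delta> \<longrightarrow>
          \<bar>W (z + r *\<^sub>R d) - W (z + s *\<^sub>R d)\<bar> \<le> M * \<bar>r - s\<bar>"
        by blast
    qed
    then show ?thesis by simp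
  qed
  have neg_F: "negligible F"
    unfolding F_def using N(1) negligible_frontiers by (rule negligible_Un)
  have uW: "u x = W x" if "x \<notin> F" for x
  proof (cases "x \<in> \<Union>\<T>")
    case True
    then obtain T where T: "T \<in> \<T>" "x \<in> T" by blast
    then have "x \<in> interior T" using that in_interior unfolding F_def by blast
    then show ?thesis unfolding u_def using pw_interior[OF T(1)] W_eq[OF T] that F_def by simp
  next
    case False
    then show ?thesis unfolding u_def using pw_outside outside by simp
  qed
  have u_int: "integrable lborel u"
    unfolding u_def using Q by (intro pw_integrable C_k_1_continuous)
  obtain R where R: "\<And>x. \<phi> x \<noteq> 0 \<Longrightarrow> norm x \<le> R"
    using \<phi>(2) unfolding bounded_iff by auto
  have u_supp: "u x = 0" if "norm x > R" for x
    unfolding u_def pw_def Q_def using R[of x] that by force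
  define D where "D n x = (u (inverse (real (Suc n)) *\<^sub>R d + x) - u x) * real (Suc n)" for n x
  have D_int: "(\<integral>x. D n x \<partial>lborel) = 0" and D_meas: "D n \<in> borel_measurable lborel" for n
  proof -
    note tr = lborel_integral_translation[OF u_int, of "inverse (real (Suc n)) *\<^sub>R d"]
    have i: "integrable lborel (\<lambda>x. u (inverse (real (Suc n)) *\<^sub>R d + x) - u x)"
      using tr(1) u_int by (rule Bochner_Integration.integrable_diff)
    have "(\<integral>x. u (inverse (real (Suc n)) *\<^sub>R d + x) - u x \<partial>lborel) = 0"
      using tr(2) by (subst Bochner_Integration.integral_diff[OF tr(1) u_int]) simp
    then show "(\<integral>x. D n x \<partial>lborel) = 0"
      unfolding D_def by simp
    show "D n \<in> borel_measurable lborel"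
      unfolding D_def[abs_def] using borel_measurable_integrable[OF i] by (intro borel_measurable_times) auto
  qed
  have "(\<lambda>n. \<integral>x. D n x \<partial>lborel) \<longlonglongrightarrow> (\<integral>x. pw \<T> G x \<partial>lborel)"
  \<comment> \<open>Steps have length at most \<open>norm d\<close>, since the parameter is at most
    1. Beyond radius \<open>R + norm d\<close> both points of the quotient are thus outside the ball
    of radius \<open>R\<close>, where \<open>u\<close> vanishes.\<close>
  proof (rule integral_dominated_convergence[where w = "\<lambda>x. indicator (cball 0 (R + norm d)) x *\<^sub>R M"])
    show "pw \<T> G \<in> borel_measurable lborel"
      using pw_measurable[of G] C_k_1_grad_continuous[OF Q] unfolding G_def by simp
    show "integrable lborel (\<lambda>x. indicator (cball 0 (R + norm d)) x *\<^sub>R M)"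
      by (intro borel_integrable_compact) auto
    show "D n \<in> borel_measurable lborel" for n by (rule D_meas)
    show "AE x in lborel. norm (D n x) \<le> indicator (cball 0 (R + norm d)) x *\<^sub>R M" for n
      using AE_lborel_negligible[OF neg_F] AE_lborel_negligible_translate[OF neg_F, of "inverse (real (Suc n)) *\<^sub>R d"]
    proof eventually_elim
      fix x
      define t where "t = inverse (real (Suc n))"
      assume *: "x \<notin> F" "x + inverse (real (Suc n)) *\<^sub>R d \<notin> F"
      have t: "0 < t" "t \<le> 1" unfolding t_def by (auto simp: inverse_le_1_iff)
      have D: "D n x = (u (x + t *\<^sub>R d) - u x) / t"
        unfolding D_def t_def by (simp add: add.commute field_simps)
      show "norm (D n x) \<le> indicator (cball 0 (R + norm d)) x *\<^sub>R M"
      proof (cases "norm x \<le> R + norm d")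
        case True
        have "\<bar>u (x + t *\<^sub>R d) - u x\<bar> \<le> M * t"
          using * uW W_lip[of x t] t unfolding F_def t_def by auto
        then show ?thesis using True t by (simp add: D pos_divide_le_eq)
      next
        case False
        have "norm x \<le> norm (x + t *\<^sub>R d) + norm (t *\<^sub>R d)"
          by (metis add_diff_cancel_right' norm_triangle_ineq4)
        moreover have "norm (t *\<^sub>R d) \<le> norm d" using t by (simp add: mult_left_le_one_le)
        moreover have "norm x > R" using False norm_ge_zero[of d] by linarith
        ultimately have "u (x + t *\<^sub>R d) = 0" "u x = 0" using False by (auto intro!: u_supp)
        then show ?thesis using False by (simp add: D)
      qed
    qed
    show "AE x in lborel. (\<lambda>n. D n x) \<longlonglongrightarrow> pw \<T> G x"
      using AE_lborel_negligible[OF neg_F]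
    proof eventually_elim
      fix x assume x: "x \<notin> F"
      \<comment> \<open>Off the frontiers, \<open>u\<close> is locally either a single
        \<open>Q T\<close> or zero, so the pointwise limit is a classical directional
        derivative.\<close>
      have "\<exists>f S. open S \<and> x \<in> S \<and> (\<forall>y\<in>S. u y = f y) \<and> (f has_derivative (\<lambda>h. grad f x \<bullet> h)) (at x)
        \<and> grad f x \<bullet> d = pw \<T> G x"
      proof (cases "x \<in> \<Union>\<T>")
        case True
        then obtain T where T: "T \<in> \<T>" "x \<in> T" by blast
        then have "x \<in> interior T" using x in_interior unfolding F_def by blast
        then show ?thesis
          using T C_k_1_has_derivative[OF Q] pw_interior[OF T(1)]
          by (intro exI[of _ "Q T"] exI[of _ "interior T"]) (auto simp: u_def G_def)
      next
        case False
        have D0: "((\<lambda>_. 0::real) has_derivative (\<lambda>h. 0)) (at x)" by simp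
        have "grad (\<lambda>_. 0) x \<bullet> h = 0" for h
          using has_derivative_imp_grad_inner[OF D0] .
        then show ?thesis
          using False closed_Union pw_outside
          by (intro exI[of _ "\<lambda>_. 0"] exI[of _ "- \<Union>\<T>"]) (auto simp: u_def)
      qed
      then obtain f S where S: "open S" "x \<in> S" "\<And>y. y \<in> S \<Longrightarrow> u y = f y"
        "(f has_derivative (\<lambda>h. grad f x \<bullet> h)) (at x)" "grad f x \<bullet> d = pw \<T> G x"
        by blast
      have "(u has_derivative (\<lambda>h. grad f x \<bullet> h)) (at x)"
        using S by (intro has_derivative_transform_within_open[OF S(4) S(1,2)]) simp
      then have "((\<lambda>t. u (x + t *\<^sub>R d)) has_derivative (\<lambda>t. grad f x \<bullet> (t *\<^sub>R d))) (at 0)"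
        by (intro has_derivative_compose[where f = "\<lambda>t. x + t *\<^sub>R d" and g = u])
          (auto intro!: derivative_eq_intros)
      then have "((\<lambda>t. u (x + t *\<^sub>R d)) has_field_derivative pw \<T> G x) (at 0)"
        unfolding has_field_derivative_def using S(5) by (simp add: mult.commute[of _ "pw \<T> G x"])
      then have "((\<lambda>t. (u (x + t *\<^sub>R d) - u x) / t) \<longlongrightarrow> pw \<T> G x) (at 0)"
        unfolding DERIV_def by simp
      moreover have "filterlim (\<lambda>n. inverse (real (Suc n))) (at 0) sequentially"
        using LIMSEQ_inverse_real_of_nat by (auto simp: filterlim_at)
      ultimately have "(\<lambda>n. (u (x + inverse (real (Suc n)) *\<^sub>R d) - u x) / inverse (real (Suc n)))
          \<longlonglongrightarrow> pw \<T> G x"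
        by (rule filterlim_compose)
      then show "(\<lambda>n. D n x) \<longlonglongrightarrow> pw \<T> G x"
        unfolding D_def by (simp add: add.commute divide_inverse)
    qed
  qed
  then have zero: "(\<integral>x. pw \<T> G x \<partial>lborel) = 0"
    by (simp add: D_int LIMSEQ_const_iff)
  have i1: "integrable lborel (\<lambda>x. pw \<T> P x * (grad \<phi> x \<bullet> d))"
    by (intro pw_mult_integrable C_k_1_continuous P C_k_1_grad_continuous \<phi>(1))
  have i2: "integrable lborel (\<lambda>x. pw \<T> (\<lambda>T x. grad (P T) x \<bullet> d) x * \<phi> x)"
    by (intro pw_mult_integrable C_k_1_continuous P C_k_1_grad_continuous \<phi>(1))
  \<comment> \<open>The product rule splits the integrand of integral zero into the two sides of the
    claim.\<close>
  have "pw \<T> G x = pw \<T> P x * (grad \<phi> x \<bullet> d) + pw \<T> (\<lambda>T x. grad (P T) x \<bullet> d) x * \<phi> x" for x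
  proof -
    have "pw \<T> G x = pw \<T> (\<lambda>T x. P T x * (grad \<phi> x \<bullet> d) + (grad (P T) x \<bullet> d) * \<phi> x) x"
      unfolding pw_def by (intro sum.cong) (auto simp: G)
    then show ?thesis by (simp add: pw_add pw_mult)
  qed
  then show ?thesis
    using zero by (simp add: Bochner_Integration.integral_add[OF i1 i2])
qed

section \<open>Transfer to Lebesgue integrals over the domain\<close>

lemma pw_AE_eq:
  assumes "\<Omega> \<subseteq> \<Union>\<T>" "\<And>T x. T \<in> \<T> \<Longrightarrow> x \<in> interior T \<Longrightarrow> v x = Q T x"
  shows "AE x in lebesgue. x \<in> \<Omega> \<longrightarrow> v x = pw \<T> Q x"
proof -
  have "AE x in lborel. x \<in> \<Omega> \<longrightarrow> v x = pw \<T> Q x"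
    using AE_lborel_negligible[OF negligible_frontiers]
  proof eventually_elim
    fix x assume x: "x \<notin> (\<Union>T\<in>\<T>. frontier T)"
    show "x \<in> \<Omega> \<longrightarrow> v x = pw \<T> Q x"
    proof
      assume "x \<in> \<Omega>"
      then obtain T where T: "T \<in> \<T>" "x \<in> T" using assms(1) by blast
      then have "x \<in> interior T" using x by (rule in_interior)
      then show "v x = pw \<T> Q x" using assms(2)[OF T(1)] pw_interior[OF T(1)] by simp
    qed
  qed
  then show ?thesis by (rule AE_completion)
qed

text \<open>Since \<open>v\<close> is prescribed only on interiors, it need not be Borel; its
  Lebesgue measurability comes from almost everywhere equality with the Borel function
  \<open>pw \<T> Q\<close>. Its square is again piecewise, with the pieces
  \<open>Q T x * Q T x\<close>.\<close>

lemma pw_L2: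
  assumes \<Omega>: "\<Omega> \<in> sets borel" "\<Omega> \<subseteq> \<Union>\<T>"
    and v: "\<And>T x. T \<in> \<T> \<Longrightarrow> x \<in> interior T \<Longrightarrow> v x = Q T x"
    and Q: "\<And>T. T \<in> \<T> \<Longrightarrow> continuous_on UNIV (Q T)"
  shows "v \<in> L2 \<Omega>"
proof -
  have m: "(\<lambda>x. indicator \<Omega> x *\<^sub>R pw \<T> Q x) \<in> borel_measurable lebesgue"
    using pw_measurable[OF Q] \<Omega>(1) by (intro measurable_completion borel_measurable_scaleR) auto
  have AE1: "AE x in lebesgue. x \<in> \<Omega> \<longrightarrow> v x = pw \<T> Q x"
    using \<Omega>(2) v by (rule pw_AE_eq)
  have "AE x in lebesgue. indicator \<Omega> x *\<^sub>R pw \<T> Q x = indicator \<Omega> x *\<^sub>R v x"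
    using AE1 by eventually_elim (auto simp: indicator_def)
  with m have "(\<lambda>x. indicator \<Omega> x *\<^sub>R v x) \<in> borel_measurable lebesgue"
    by (rule borel_measurable_AE)
  then have vm: "v \<in> borel_measurable (lebesgue_on \<Omega>)"
    using \<Omega>(1) by (subst borel_measurable_restrict_space_iff) auto
  have "integrable lborel (pw \<T> (\<lambda>T x. Q T x * Q T x))"
    by (intro pw_integrable continuous_on_mult Q)
  then have "integrable lebesgue (pw \<T> (\<lambda>T x. Q T x * Q T x))"
    by (simp add: integrable_completion borel_measurable_integrable)
  then have "integrable (lebesgue_on \<Omega>) (pw \<T> (\<lambda>T x. Q T x * Q T x))"
    using \<Omega>(1) by (subst integrable_restrict_space) (auto intro!: integrable_mult_indicator simp del: real_scaleR_def)
  moreover have "AE x in lebesgue_on \<Omega>. pw \<T> (\<lambda>T x. Q T x * Q T x) x = (v x)\<^sup>2"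
  proof -
    have "AE x in lebesgue. x \<in> \<Omega> \<longrightarrow> (v x)\<^sup>2 = pw \<T> (\<lambda>T x. Q T x * Q T x) x"
      by (rule pw_AE_eq[OF \<Omega>(2)]) (simp add: v power2_eq_square)
    then show ?thesis
      using \<Omega>(1) by (subst AE_restrict_space_iff) auto
  qed
  ultimately have "integrable (lebesgue_on \<Omega>) (\<lambda>x. (v x)\<^sup>2)"
    by (rule integrable_cong_AE_imp[OF _ borel_measurable_power[OF vm]])
  with vm show ?thesis by (simp add: L2_def)
qed

lemma integral_lebesgue_on_pw:
  assumes \<Omega>: "\<Omega> \<in> sets borel" "\<Omega> \<subseteq> \<Union>\<T>"
    and v: "\<And>T x. T \<in> \<T> \<Longrightarrow> x \<in> interior T \<Longrightarrow> v x = Q T x"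
    and Q: "\<And>T. T \<in> \<T> \<Longrightarrow> continuous_on UNIV (Q T)"
    and h: "continuous_on UNIV h" "\<And>x. x \<notin> \<Omega> \<Longrightarrow> h x = 0"
  shows "integral\<^sup>L (lebesgue_on \<Omega>) (\<lambda>x. v x * h x) = (\<integral>x. pw \<T> Q x * h x \<partial>lborel)"
proof -
  have m: "(\<lambda>x. pw \<T> Q x * h x) \<in> borel_measurable borel"
    using pw_measurable[OF Q] borel_measurable_continuous_onI[OF h(1)] by (intro borel_measurable_times) auto
  then have ml: "(\<lambda>x. pw \<T> Q x * h x) \<in> borel_measurable lebesgue"
    by (intro measurable_completion) auto
  have AE1: "AE x in lebesgue. x \<in> \<Omega> \<longrightarrow> v x = pw \<T> Q x"
    using \<Omega>(2) v by (rule pw_AE_eq)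
  have AE: "AE x in lebesgue. pw \<T> Q x * h x = indicator \<Omega> x *\<^sub>R (v x * h x)"
    using AE1 by eventually_elim (auto simp: indicator_def h)
  have "integral\<^sup>L (lebesgue_on \<Omega>) (\<lambda>x. v x * h x) = (\<integral>x. indicator \<Omega> x *\<^sub>R (v x * h x) \<partial>lebesgue)"
    using \<Omega>(1) by (intro integral_restrict_space) auto
  also have "\<dots> = (\<integral>x. pw \<T> Q x * h x \<partial>lebesgue)"
    using AE by (intro integral_cong_AE borel_measurable_AE[OF ml AE] ml) auto
  also have "\<dots> = (\<integral>x. pw \<T> Q x * h x \<partial>lborel)"
    using m by (intro integral_completion) auto
  finally show ?thesis .
qed

end

section \<open>Matching across edges\<close>

lemma bar_edge_normal:
  "bar (edge_normal p q) $ 1 = edge_tangent p q $ 2" "bar (edge_normal p q) $ 2 = edge_tangent p q $ 1"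
  by (simp_all add: bar_def edge_normal_def)

text \<open>The vector \<open>bar n\<close> is the tangent with its coordinates swapped, so type I
  means that the swap fixes or negates the tangent; scaling by the length of the edge does not
  affect this.\<close>

lemma type_I_iff: "type_I p q \<longleftrightarrow> (q - p) $ 2 = (q - p) $ 1 \<or> (q - p) $ 2 = - ((q - p) $ 1)"
proof (cases "p = q")
  case True
  then have "edge_tangent p q = 0" by (simp add: edge_tangent_def)
  with True show ?thesis by (simp add: type_I_def vec_eq_iff forall_2 bar_edge_normal)
next
  case False
  define c e where "c = inverse (norm (q - p))" and "e = q - p"
  have "c \<noteq> 0" using False by (simp add: c_def)
  have t: "edge_tangent p q $ i = c * e $ i" for i
    by (simp add: edge_tangent_def sgn_div_norm c_def e_def)
  have "(c * e $ 2 = c * e $ 1) \<longleftrightarrow> e $ 2 = e $ 1" "(c * e $ 1 = c * e $ 2) \<longleftrightarrow> e $ 2 = e $ 1"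
    "(c * e $ 2 = - (c * e $ 1)) \<longleftrightarrow> e $ 2 = - (e $ 1)" "(c * e $ 1 = - (c * e $ 2)) \<longleftrightarrow> e $ 2 = - (e $ 1)"
    using \<open>c \<noteq> 0\<close> unfolding mult_minus_right[symmetric] mult_cancel_left by auto
  then show ?thesis
    unfolding type_I_def vec_eq_iff forall_2 bar_edge_normal vector_uminus_component t e_def[symmetric]
    by simp
qed

lemma collinear_if_det_zero:
  fixes x y :: "real^2"
  assumes "x $ 1 * y $ 2 = x $ 2 * y $ 1"
  shows "collinear {0, x, y}"
proof (cases "x = 0")
  case False
  then consider "x $ 1 \<noteq> 0" | "x $ 2 \<noteq> 0" by (auto simp: vec_eq_iff forall_2)
  then have "\<exists>c. y = c *\<^sub>R x"
  proof cases
    case 1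
    with assms show ?thesis
      by (intro exI[of _ "y $ 1 / x $ 1"]) (simp add: vec_eq_iff forall_2 field_simps)
  next
    case 2
    with assms show ?thesis
      by (intro exI[of _ "y $ 2 / x $ 2"]) (simp add: vec_eq_iff forall_2 field_simps)
  qed
  then show ?thesis by (simp add: collinear_lemma)
qed (simp add: collinear_lemma)

lemma triangle_vertices: "a ` {1..3::nat} = {a 1, a 2, a 3}"
proof -
  have "{1..3::nat} = {1, 2, 3}" by auto
  then show ?thesis by simp
qed

lemma triangle_nondegenerate:
  assumes "triangle_with T a"
  shows "(a 2 - a 1) $ 1 * (a 3 - a 1) $ 2 \<noteq> (a 2 - a 1) $ 2 * (a 3 - a 1) $ 1"
proof
  assume "(a 2 - a 1) $ 1 * (a 3 - a 1) $ 2 = (a 2 - a 1) $ 2 * (a 3 - a 1) $ 1"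
  then have "collinear {0, a 2 - a 1, a 3 - a 1}" by (rule collinear_if_det_zero)
  then have "collinear {a 2, a 1, a 3}" by (subst collinear_3) (simp_all add: NO_MATCH_def)
  moreover have "{a 2, a 1, a 3} = a ` {1..3}" unfolding triangle_vertices by auto
  moreover have "a 1 \<noteq> a 2" "a 1 \<noteq> a 3" "a 2 \<noteq> a 3"
    using assms inj_onD[of a "{1..3}"] unfolding triangle_with_def by fastforce+
  ultimately show False
    using assms unfolding triangle_with_def by (auto simp: collinear_3_eq_affine_dependent)
qed

text \<open>That the third edge is of type II has to be derived. Two non-parallel type I edges lie
  one on each diagonal direction, say \<open>(s, s)\<close> and \<open>(t, -t)\<close> with
  \<open>s\<close> and \<open>t\<close> nonzero, and their sum \<open>(s + t, s - t)\<close> has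
  neither diagonal direction.\<close>

lemma labelled_exists:
  assumes "two_type_I_edges T"
  obtains a where "labelled T a"
proof -
  obtain a where a: "triangle_with T a" "type_I (a 2) (a 3)" "type_I (a 3) (a 1)"
    using assms unfolding two_type_I_edges_def by blast
  define x y where "x = a 3 - a 2" and "y = a 1 - a 3"
  have "x $ 1 * y $ 2 \<noteq> x $ 2 * y $ 1"
    using triangle_nondegenerate[OF a(1)] unfolding x_def y_def by (simp add: algebra_simps)
  moreover have "x $ 2 = x $ 1 \<or> x $ 2 = - (x $ 1)" "y $ 2 = y $ 1 \<or> y $ 2 = - (y $ 1)"
    using a(2,3) unfolding type_I_iff x_def y_def by auto
  ultimately have "\<not> ((x + y) $ 2 = (x + y) $ 1 \<or> (x + y) $ 2 = - ((x + y) $ 1))"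
    by (elim disjE) auto
  moreover have "a 2 - a 1 = - (x + y)" by (simp add: x_def y_def)
  ultimately have "\<not> type_I (a 1) (a 2)"
    unfolding type_I_iff by simp
  with a that show thesis unfolding labelled_def by blast
qed

section \<open>Vanishing of a quartic, and of its gradient, on an edge\<close>

lemma polys_diff:
  assumes "p \<in> polys k" "q \<in> polys k"
  shows "(\<lambda>x. p x - q x) \<in> polys k"
    and "grad (\<lambda>x. p x - q x) x \<bullet> d = grad p x \<bullet> d - grad q x \<bullet> d"
proof -
  show "(\<lambda>x. p x - q x) \<in> polys k"
    using polys_add[OF assms(1) polys_cmult[OF assms(2), of "- 1"]] by simp
  show "grad (\<lambda>x. p x - q x) x \<bullet> d = grad p x \<bullet> d - grad q x \<bullet> d"
    using has_derivative_imp_grad_inner[OF has_derivative_diff[OF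
      assms[THEN polys_C_k_1, THEN C_k_1_has_derivative]]] .
qed

lemma polys_on_line_derivative:
  assumes "q \<in> polys k"
  obtains r :: "real poly" where "degree r \<le> k" "\<And>t. q (a + t *\<^sub>R e) = poly r t"
    "\<And>t. grad q (a + t *\<^sub>R e) \<bullet> e = poly (pderiv r) t"
proof -
  obtain r :: "real poly" where r: "degree r \<le> k" "\<And>t. q (a + t *\<^sub>R e) = poly r t"
    using polys_on_line[OF assms] by metis
  have "grad q (a + t *\<^sub>R e) \<bullet> e = poly (pderiv r) t" for t
  proof -
    have "((\<lambda>t. q (a + t *\<^sub>R e)) has_derivative (\<lambda>h. grad q (a + t *\<^sub>R e) \<bullet> (h *\<^sub>R e))) (at t)"
      by (intro has_derivative_compose[where f = "\<lambda>t. a + t *\<^sub>R e" and g = q]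
        C_k_1_has_derivative[OF polys_C_k_1[OF assms]]) (auto intro!: derivative_eq_intros)
    then have "((\<lambda>t. q (a + t *\<^sub>R e)) has_field_derivative grad q (a + t *\<^sub>R e) \<bullet> e) (at t)"
      unfolding has_field_derivative_def by (simp add: mult.commute[of _ "grad q (a + t *\<^sub>R e) \<bullet> e"])
    then show ?thesis
      unfolding r(2) using poly_DERIV DERIV_unique by blast
  qed
  with r show thesis by (rule that)
qed

lemma poly_degree_le_4:
  fixes r :: "real poly"
  assumes "degree r \<le> 4"
  shows "r = [:coeff r 0, coeff r 1, coeff r 2, coeff r 3, coeff r 4:]"
proof (rule poly_eqI)
  fix n
  have "n = (0::nat) \<or> n = 1 \<or> n = 2 \<or> n = 3 \<or> n = 4 \<or> 4 < n" by arith
  then show "coeff r n = coeff [:coeff r 0, coeff r 1, coeff r 2, coeff r 3, coeff r 4:] n"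
    using assms by (auto simp: numeral_eq_Suc coeff_pCons coeff_eq_0 split: nat.split)
qed

text \<open>Double zeros at 0 and 1 and a zero at 1/2 amount to five zeros with multiplicity, too
  many for degree 4. This is the trace on a type II edge.\<close>

lemma quartic_Hermite_midpoint_zero:
  fixes r :: "real poly"
  assumes "degree r \<le> 4" "poly r 0 = 0" "poly r 1 = 0" "poly r (1/2) = 0"
    "poly (pderiv r) 0 = 0" "poly (pderiv r) 1 = 0"
  shows "r = 0"
proof -
  obtain a b c d e where r: "r = [:a, b, c, d, e:]" using poly_degree_le_4[OF assms(1)] by blast
  show ?thesis using assms(2-) unfolding r by (simp add: pderiv_pCons field_simps)
qed

text \<open>Again five zeros with multiplicity, only the one at 0 being double. This is the trace on
  a type I edge.\<close>

lemma quartic_Hermite_thirds_zero: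
  fixes r :: "real poly"
  assumes "degree r \<le> 4" "poly r 0 = 0" "poly r 1 = 0" "poly r (1/3) = 0" "poly r (2/3) = 0"
    "poly (pderiv r) 0 = 0"
  shows "r = 0"
proof -
  obtain a b c d e where r: "r = [:a, b, c, d, e:]" using poly_degree_le_4[OF assms(1)] by blast
  show ?thesis using assms(2-) unfolding r by (simp add: pderiv_pCons field_simps)
qed

text \<open>Four zeros against degree 3. This is a transversal derivative of a quartic along a type
  II edge.\<close>

lemma cubic_thirds_zero:
  fixes r :: "real poly"
  assumes "degree r \<le> 3" "poly r 0 = 0" "poly r 1 = 0" "poly r (1/3) = 0" "poly r (2/3) = 0"
  shows "r = 0"
proof -
  obtain a b c d e where r: "r = [:a, b, c, d, e:]" "e = 0"
    using poly_degree_le_4[of r] assms(1) coeff_eq_0[of r 4] by fastforce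
  show ?thesis using assms(2-) unfolding r by (simp add: pderiv_pCons field_simps)
qed

lemma inner_2: "x \<bullet> y = x $ 1 * y $ 1 + x $ 2 * y $ 2" for x y :: "real^2"
  by (simp add: inner_vec_def sum_2)

text \<open>Cramer's rule: the determinant times each coordinate of \<open>g\<close> is a
  combination of the two inner products.\<close>

lemma inner_independent_zero:
  fixes g :: "real^2"
  assumes "x $ 1 * y $ 2 \<noteq> x $ 2 * y $ 1" "g \<bullet> x = 0" "g \<bullet> y = 0"
  shows "g = 0"
proof -
  have "g $ 1 * (x $ 1 * y $ 2 - x $ 2 * y $ 1) = (g \<bullet> x) * y $ 2 - (g \<bullet> y) * x $ 2"
    "g $ 2 * (x $ 1 * y $ 2 - x $ 2 * y $ 1) = (g \<bullet> y) * x $ 1 - (g \<bullet> x) * y $ 1"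
    unfolding inner_2 by (simp_all add: algebra_simps)
  then show ?thesis using assms by (simp add: vec_eq_iff forall_2)
qed

text \<open>Applied to the difference \<open>q\<close> of two pieces, with \<open>b\<close> the
  vertex \<open>a 3\<close> of the labelling. That vertex carries no derivative, which is why the
  derivative is prescribed at one end only and two interior values are required.\<close>

lemma type_I_edge_vanishing:
  fixes q :: "real^2 \<Rightarrow> real"
  assumes q: "q \<in> polys 4" and zero: "q a = 0" "q b = 0"
    "q ((1/3) *\<^sub>R (a + a + b)) = 0" "q ((1/3) *\<^sub>R (a + b + b)) = 0" "grad q a \<bullet> (b - a) = 0"
  shows "q (a + t *\<^sub>R (b - a)) = 0" "grad q (a + t *\<^sub>R (b - a)) \<bullet> (b - a) = 0"
proof -
  obtain r :: "real poly" where r: "degree r \<le> 4" "\<And>t. q (a + t *\<^sub>R (b - a)) = poly r t"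
    "\<And>t. grad q (a + t *\<^sub>R (b - a)) \<bullet> (b - a) = poly (pderiv r) t"
    using polys_on_line_derivative[OF q, of a "b - a"] by metis
  have "(1/3) *\<^sub>R (a + a + b) = a + (1/3) *\<^sub>R (b - a)" "(1/3) *\<^sub>R (a + b + b) = a + (2/3) *\<^sub>R (b - a)"
    by (simp_all add: vec_eq_iff algebra_simps)
  then have "r = 0"
    using r(2)[of 0] r(2)[of 1] r(2)[of "1/3"] r(2)[of "2/3"] r(3)[of 0] zero
    by (intro quartic_Hermite_thirds_zero[OF r(1)]) auto
  then show "q (a + t *\<^sub>R (b - a)) = 0" "grad q (a + t *\<^sub>R (b - a)) \<bullet> (b - a) = 0"
    unfolding r by simp_all
qed

text \<open>The trace vanishes by its double zeros at the ends and the zero at the midpoint, and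
  with it the tangential derivative. The derivative in direction \<open>w\<close> is a cubic on the
  edge with zeros at both ends and at the thirds. Since \<open>w\<close> is transversal to the edge,
  the two components determine the gradient.\<close>

lemma type_II_edge_vanishing:
  fixes q :: "real^2 \<Rightarrow> real"
  assumes q: "q \<in> polys 4" and zero: "q a = 0" "q b = 0" "q (midpoint a b) = 0"
    and grad_zero: "grad q a = 0" "grad q b = 0"
    "grad q ((1/3) *\<^sub>R (a + a + b)) \<bullet> w = 0" "grad q ((1/3) *\<^sub>R (a + b + b)) \<bullet> w = 0"
    and w: "(b - a) $ 1 * w $ 2 \<noteq> (b - a) $ 2 * w $ 1"
  shows "q (a + t *\<^sub>R (b - a)) = 0" "grad q (a + t *\<^sub>R (b - a)) = 0"
proof -
  obtain r :: "real poly" where r: "degree r \<le> 4" "\<And>t. q (a + t *\<^sub>R (b - a)) = poly r t"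
    "\<And>t. grad q (a + t *\<^sub>R (b - a)) \<bullet> (b - a) = poly (pderiv r) t"
    using polys_on_line_derivative[OF q, of a "b - a"] by metis
  have "midpoint a b = a + (1/2) *\<^sub>R (b - a)"
    by (simp add: midpoint_def vec_eq_iff algebra_simps)
  then have "r = 0"
    using r(2)[of 0] r(2)[of 1] r(2)[of "1/2"] r(3)[of 0] r(3)[of 1] zero grad_zero
    by (intro quartic_Hermite_midpoint_zero[OF r(1)]) auto
  then show "q (a + t *\<^sub>R (b - a)) = 0"
    unfolding r by simp
  have "(\<lambda>x. grad q x \<bullet> w) \<in> polys 3"
    using polys_grad[of q 3] q by simp
  then obtain s :: "real poly" where s: "degree s \<le> 3" "\<And>t. grad q (a + t *\<^sub>R (b - a)) \<bullet> w = poly s t"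
    using polys_on_line[of _ 3 a "b - a"] by metis
  have "(1/3) *\<^sub>R (a + a + b) = a + (1/3) *\<^sub>R (b - a)" "(1/3) *\<^sub>R (a + b + b) = a + (2/3) *\<^sub>R (b - a)"
    by (simp_all add: vec_eq_iff algebra_simps)
  then have "s = 0"
    using s(2)[of 0] s(2)[of 1] s(2)[of "1/3"] s(2)[of "2/3"] grad_zero
    by (intro cubic_thirds_zero[OF s(1)]) auto
  then show "grad q (a + t *\<^sub>R (b - a)) = 0"
    using \<open>r = 0\<close> r(3)[of t] s(2)[of t] by (intro inner_independent_zero[OF w]) auto
qed

text \<open>By conformity \<open>T \<inter> T'\<close> is a face of \<open>T\<close>, the hull of a
  set \<open>c\<close> of vertices. At most one vertex is impossible because \<open>z\<close> is not
  a vertex; all three would make \<open>T\<close> a face of \<open>T'\<close> of full dimension,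
  hence equal to \<open>T'\<close>. The ranges of \<open>i\<close> and \<open>j\<close> orient the
  edge so that it starts at a vertex with gradient data, and \<open>j = 3\<close> marks the type I
  edges.\<close>

lemma common_edge:
  assumes "triangulation \<T>" "\<And>T. T \<in> \<T> \<Longrightarrow> 2 simplex T"
    and T: "T \<in> \<T>" "T' \<in> \<T>" "T \<noteq> T'" and a: "triangle_with T a"
    and z: "z \<in> T" "z \<in> T'" "z \<notin> a ` {1..3}"
  obtains i j t where "i \<in> {1..2}" "j \<in> {2..3}" "i \<noteq> j" "closed_segment (a i) (a j) \<subseteq> T'"
    "z = a i + t *\<^sub>R (a j - a i)"
proof -
  have faces: "(T \<inter> T') face_of T" "(T \<inter> T') face_of T'"
    using assms(1) T unfolding triangulation_def by (metis Int_commute)+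
  obtain c where c: "c \<subseteq> a ` {1..3}" "T \<inter> T' = convex hull c"
    using faces(1) a face_of_convex_hull_affine_independent unfolding triangle_with_def by metis
  have "c \<noteq> a ` {1..3}"
  proof
    assume "c = a ` {1..3}"
    then have "T \<inter> T' = T" using c a by (simp add: triangle_with_def)
    then have "T face_of T'" using faces by simp
    moreover have "convex T'" "aff_dim T = 2" "aff_dim T' = 2"
      using assms(2)[OF T(1)] assms(2)[OF T(2)] by (auto simp: aff_dim_simplex convex_simplex)
    ultimately show False using face_of_aff_dim_lt[of T' T] T(3) by auto
  qed
  moreover have "c \<noteq> {}" using c z by auto
  moreover have "c \<noteq> {a 1}" "c \<noteq> {a 2}" "c \<noteq> {a 3}"
  proof -
    have "z \<in> convex hull c" "z \<notin> {a 1, a 2, a 3}"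
      using c(2) z unfolding triangle_vertices by blast+
    then show "c \<noteq> {a 1}" "c \<noteq> {a 2}" "c \<noteq> {a 3}" by auto
  qed
  ultimately have "c = {a 1, a 2} \<or> c = {a 2, a 3} \<or> c = {a 1, a 3}"
    using c(1) unfolding triangle_vertices by blast
  then have "\<exists>i j. i \<in> {1..2} \<and> j \<in> {2..3} \<and> i \<noteq> j \<and> c = {a i, a j}"
  proof (elim disjE)
    show ?thesis if "c = {a 1, a 2}" using that by (intro exI[of _ 1] exI[of _ 2]) simp
    show ?thesis if "c = {a 2, a 3}" using that by (intro exI[of _ 2] exI[of _ 3]) simp
    show ?thesis if "c = {a 1, a 3}" using that by (intro exI[of _ 1] exI[of _ 3]) simp
  qed
  then obtain i j where ij: "i \<in> {1..2}" "j \<in> {2..3}" "i \<noteq> j" "c = {a i, a j}"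
    by blast
  then have seg: "T \<inter> T' = closed_segment (a i) (a j)"
    using c(2) by (simp add: segment_convex_hull)
  then obtain u where "z = (1 - u) *\<^sub>R a i + u *\<^sub>R a j"
    using z by (auto simp: closed_segment_def)
  then have "z = a i + u *\<^sub>R (a j - a i)" by (simp add: algebra_simps)
  with ij seg show thesis by (intro that[of i j u]) auto
qed

text \<open>One-sided on purpose: the functionals come from the labelling \<open>a\<close> of one
  triangle, and \<open>T'\<close> enters only by containing the nodes. The labellings of two
  neighbours never have to be compared.\<close>

definition dofs_match :: "(nat \<Rightarrow> real^2) \<Rightarrow> (real^2) set \<Rightarrow> (real^2 \<Rightarrow> real) \<Rightarrow> (real^2 \<Rightarrow> real) \<Rightarrow> bool" where
  "dofs_match a T' p p' \<longleftrightarrow> (\<forall>(x, l)\<in>dofs4 a. x \<in> T' \<longrightarrow> l p' = l p)"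

lemma dofs_match_value: "dofs_match a T' p p' \<Longrightarrow> val_dof x \<in> dofs4 a \<Longrightarrow> x \<in> T' \<Longrightarrow> p' x = p x"
  unfolding dofs_match_def val_dof_def by (drule (1) bspec) simp

lemma dofs_match_derivative:
  "dofs_match a T' p p' \<Longrightarrow> der_dof d x \<in> dofs4 a \<Longrightarrow> x \<in> T' \<Longrightarrow> grad p' x \<bullet> d = grad p x \<bullet> d"
  unfolding dofs_match_def der_dof_def by (drule (1) bspec) simp

lemma thirds_in_segment:
  "(1/3) *\<^sub>R (a + a + b) \<in> closed_segment a b" "(1/3) *\<^sub>R (a + b + b) \<in> closed_segment a (b :: real^2)"
proof -
  have *: "(1/3) *\<^sub>R (a + a + b) = (1 - 1/3) *\<^sub>R a + (1/3) *\<^sub>R b"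
    "(1/3) *\<^sub>R (a + b + b) = (1 - 2/3) *\<^sub>R a + (2/3) *\<^sub>R b"
    by (simp_all add: vec_eq_iff algebra_simps)
  show "(1/3) *\<^sub>R (a + a + b) \<in> closed_segment a b"
    unfolding * closed_segment_def by (intro CollectI exI[of _ "1/3"] conjI refl) simp_all
  show "(1/3) *\<^sub>R (a + b + b) \<in> closed_segment a b"
    unfolding * closed_segment_def by (intro CollectI exI[of _ "2/3"] conjI refl) simp_all
qed

text \<open>The degrees of freedom located on the edge annihilate the difference
  \<open>p' - p\<close>, so the vanishing results for the two types of edges apply. The disjunction
  records what each type yields: the whole gradient on a type II edge, the tangential component on a
  type I edge.\<close>

lemma edge_matching:
  assumes a: "labelled T a" and p: "p \<in> polys 4" "p' \<in> polys 4"
    and dofs: "dofs_match a T' p p'"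
    and ij: "i \<in> {1..2}" "j \<in> {2..3}" "i \<noteq> j"
    and seg: "closed_segment (a i) (a j) \<subseteq> T'"
    and z: "z = a i + t *\<^sub>R (a j - a i)"
  shows "p' z = p z"
    and "grad p' z = grad p z \<or> type_I (a i) (a j) \<and> (grad p' z - grad p z) \<bullet> (a j - a i) = 0"
proof -
  define q where "q x = p' x - p x" for x
  have q: "q \<in> polys 4" and gq: "grad q x \<bullet> d = grad p' x \<bullet> d - grad p x \<bullet> d" for x d
    using polys_diff[OF p(2,1)] unfolding q_def[abs_def] by auto
  have val: "q x = 0" if "val_dof x \<in> dofs4 a" "x \<in> closed_segment (a i) (a j)" for x
    using dofs_match_value[OF dofs that(1)] that(2) seg by (auto simp: q_def)
  have der: "grad q x \<bullet> d = 0" if "der_dof d x \<in> dofs4 a" "x \<in> closed_segment (a i) (a j)" for x d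
    using dofs_match_derivative[OF dofs that(1)] that(2) seg by (auto simp: gq)
  have grad_diff: "grad q x = grad p' x - grad p x" for x
    by (rule vector_eq_rdot[THEN iffD1]) (simp add: gq inner_diff_left)
  have vertex: "val_dof (a k) \<in> dofs4 a" if "k \<in> {1..3}" for k
    using that unfolding dofs4_def by blast
  have vertex_der: "der_dof (a l - a k) (a k) \<in> dofs4 a" if "k \<in> {1..2}" "l \<in> {1..3}" "l \<noteq> k" for k l
    using that unfolding dofs4_def by blast
  have ends: "a i \<in> closed_segment (a i) (a j)" "a j \<in> closed_segment (a i) (a j)" by auto
  show "p' z = p z"
    and "grad p' z = grad p z \<or> type_I (a i) (a j) \<and> (grad p' z - grad p z) \<bullet> (a j - a i) = 0"
  proof -
    have "q z = 0 \<and> (grad q z = 0 \<or> type_I (a i) (a j) \<and> grad q z \<bullet> (a j - a i) = 0)"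
    proof (cases "j = 3")
      case True
      have "val_dof (node a i i 3) \<in> dofs4 a" "val_dof (node a i 3 3) \<in> dofs4 a"
        using ij unfolding dofs4_def by blast+
      then have nodes: "q ((1/3) *\<^sub>R (a i + a i + a j)) = 0" "q ((1/3) *\<^sub>R (a i + a j + a j)) = 0"
        using val thirds_in_segment[of "a i" "a j"] unfolding node_def True by auto
      have zeros: "q (a i) = 0" "q (a j) = 0" "grad q (a i) \<bullet> (a j - a i) = 0"
        using ij True by (intro val der vertex vertex_der ends; simp)+
      have "i = 1 \<or> i = 2" using ij by auto
      then have "type_I (a i) (a j)"
        using a True unfolding labelled_def type_I_iff by (auto simp: algebra_simps)
      with type_I_edge_vanishing[OF q zeros(1,2) nodes zeros(3)] show ?thesis
        unfolding z by blast
    next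
      case False
      then have ij12: "i = 1" "j = 2" using ij by auto
      define w where "w = bar (edge_normal (a 1) (a 2))"
      define e where "e = a 2 - a 1"
      \<comment> \<open>Swapping coordinates turns the determinant of \<open>e\<close> and
        \<open>w\<close> into a positive multiple of
        \<open>(e $ 1)\<^sup>2 - (e $ 2)\<^sup>2\<close>, which is nonzero because the edge is of
        type II.\<close>
      have w: "w $ 1 = inverse (norm e) * e $ 2" "w $ 2 = inverse (norm e) * e $ 1"
        by (simp_all add: w_def e_def bar_edge_normal edge_tangent_def sgn_div_norm)
      have det: "(a 2 - a 1) $ 1 * (a 3 - a 1) $ 2 \<noteq> (a 2 - a 1) $ 2 * (a 3 - a 1) $ 1"
        using triangle_nondegenerate a unfolding labelled_def by blast
      have "e $ 2 \<noteq> e $ 1" "e $ 2 \<noteq> - (e $ 1)"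
        using a unfolding labelled_def type_I_iff e_def by auto
      then have "(e $ 1)\<^sup>2 \<noteq> (e $ 2)\<^sup>2" by (auto simp: power2_eq_iff)
      moreover have "e \<noteq> 0" using \<open>e $ 2 \<noteq> e $ 1\<close> by auto
      ultimately have "e $ 1 * w $ 2 \<noteq> e $ 2 * w $ 1"
        unfolding w by (simp add: power2_eq_square)
      then have indep: "(a j - a i) $ 1 * w $ 2 \<noteq> (a j - a i) $ 2 * w $ 1"
        by (simp add: e_def ij12)
      have "val_dof (midpoint (a 1) (a 2)) \<in> dofs4 a"
        unfolding dofs4_def by blast
      then have mid: "q (midpoint (a i) (a j)) = 0"
        using val[of "midpoint (a 1) (a 2)"] midpoint_in_closed_segment ij12 by auto
      have "der_dof w (node a 1 1 2) \<in> dofs4 a" "der_dof w (node a 1 2 2) \<in> dofs4 a"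
        unfolding dofs4_def w_def by blast+
      then have nodes: "grad q ((1/3) *\<^sub>R (a i + a i + a j)) \<bullet> w = 0" "grad q ((1/3) *\<^sub>R (a i + a j + a j)) \<bullet> w = 0"
        using der thirds_in_segment[of "a i" "a j"] unfolding node_def ij12 by auto
      have zeros: "q (a i) = 0" "q (a j) = 0"
        using ij by (intro val vertex ends; simp)+
      \<comment> \<open>At each end of the type II edge the element prescribes derivatives along
        both edges of the triangle meeting there. These directions are independent, so the node at
        that end controls the full gradient.\<close>
      have "grad q (a i) = 0"
        by (rule inner_independent_zero[OF det]) (use der vertex_der ends ij12 in auto)
      moreover have "grad q (a j) = 0"
      proof (rule inner_independent_zero[of "a 1 - a 2" "a 3 - a 2"])
        show "(a 1 - a 2) $ 1 * (a 3 - a 2) $ 2 \<noteq> (a 1 - a 2) $ 2 * (a 3 - a 2) $ 1"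
          using det by (simp add: algebra_simps)
      qed (use der vertex_der ends ij12 in auto)
      ultimately show ?thesis
        using type_II_edge_vanishing[OF q zeros mid _ _ nodes indep] unfolding z by blast
    qed
    then show "p' z = p z"
      and "grad p' z = grad p z \<or> type_I (a i) (a j) \<and> (grad p' z - grad p z) \<bullet> (a j - a i) = 0"
      unfolding grad_diff q_def by auto
  qed
qed

text \<open>The lines through the points of \<open>A\<close> with normal \<open>n\<close>.
  Describing them by a normal makes them hyperplanes, hence null sets, and reduces invariance along
  \<open>d\<close> to \<open>n \<bullet> d = 0\<close>.\<close>

definition vertex_lines :: "(real^2) set \<Rightarrow> real^2 \<Rightarrow> (real^2) set" where
  "vertex_lines A n = (\<Union>a\<in>A. {z. n \<bullet> z = n \<bullet> a})"

lemma negligible_vertex_lines: "finite A \<Longrightarrow> n \<noteq> 0 \<Longrightarrow> negligible (vertex_lines A n)"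
  unfolding vertex_lines_def by (intro negligible_Union) (auto intro: negligible_hyperplane)

lemma vertex_lines_invariant:
  "z \<notin> vertex_lines A n \<Longrightarrow> n \<bullet> d = 0 \<Longrightarrow> z + t *\<^sub>R d \<notin> vertex_lines A n"
  by (auto simp: vertex_lines_def inner_right_distrib)

text \<open>Both \<open>m\<close> and the edge have diagonal direction, so they are parallel or
  orthogonal. As \<open>z\<close> is off the line through \<open>a\<close> with normal
  \<open>m\<close>, they are not orthogonal; thus \<open>m\<close> is a multiple of the edge vector
  and the derivative along \<open>m\<close> is tangential.\<close>

lemma type_I_matching:
  assumes "type_I a b" and g: "(g' - g) \<bullet> (b - a) = 0" and m: "m \<noteq> 0" "m $ 2 = m $ 1 \<or> m $ 2 = - (m $ 1)"
    and z: "z = a + t *\<^sub>R (b - a)" "m \<bullet> z \<noteq> m \<bullet> a"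
  shows "g' \<bullet> m = g \<bullet> m"
proof -
  define e where "e = b - a"
  have e: "e $ 2 = e $ 1 \<or> e $ 2 = - (e $ 1)" using assms(1) unfolding type_I_iff e_def .
  have "m \<bullet> e \<noteq> 0" using z by (auto simp: e_def inner_right_distrib)
  then have ne: "m $ 1 * e $ 1 + m $ 2 * e $ 2 \<noteq> 0" by (simp add: inner_2)
  then have e1: "e $ 1 \<noteq> 0" using e by auto
  have "m = (m $ 1 / e $ 1) *\<^sub>R e"
    using e m(2) ne e1 by (auto simp: vec_eq_iff forall_2)
  then obtain c where c: "m = c *\<^sub>R e" by blast
  have "(g' - g) \<bullet> m = 0" using g unfolding c e_def[symmetric] by simp
  then show ?thesis by (simp add: inner_diff_left)
qed

section \<open>The inclusion\<close>

lemma test_functionsD: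
  assumes "\<phi> \<in> test_functions \<Omega>"
  shows "C_k 1 \<phi>" "bounded {x. \<phi> x \<noteq> 0}" "x \<notin> \<Omega> \<Longrightarrow> \<phi> x = 0"
proof -
  have supp: "compact (closure {x. \<phi> x \<noteq> 0})" "closure {x. \<phi> x \<noteq> 0} \<subseteq> \<Omega>" and C: "\<forall>k. C_k k \<phi>"
    using assms unfolding test_functions_def by auto
  show "C_k 1 \<phi>" using C by blast
  show "bounded {x. \<phi> x \<noteq> 0}"
    using compact_imp_bounded[OF supp(1)] closure_subset by (rule bounded_subset)
  show "\<phi> x = 0" if "x \<notin> \<Omega>"
  proof (rule ccontr)
    assume "\<phi> x \<noteq> 0"
    then have "x \<in> closure {x. \<phi> x \<noteq> 0}" by (intro subsetD[OF closure_subset]) simp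
    with supp(2) that show False by blast
  qed
qed

lemma test_functions_grad:
  assumes "\<phi> \<in> test_functions \<Omega>"
  shows "C_k 1 (\<lambda>x. grad \<phi> x \<bullet> d)" "bounded {x. grad \<phi> x \<bullet> d \<noteq> 0}" "x \<notin> \<Omega> \<Longrightarrow> grad \<phi> x \<bullet> d = 0"
    and "grad (\<lambda>x. grad \<phi> x \<bullet> d) x \<bullet> m
      = (d $ 1 * pd 1 (pd 1 \<phi>) x + d $ 2 * pd 1 (pd 2 \<phi>) x) * m $ 1
        + (d $ 1 * pd 2 (pd 1 \<phi>) x + d $ 2 * pd 2 (pd 2 \<phi>) x) * m $ 2"
proof -
  note P = test_functions_pd[OF assms]
  have eq: "(\<lambda>x. grad \<phi> x \<bullet> d) = (\<lambda>x. d $ 1 * pd 1 \<phi> x + d $ 2 * pd 2 \<phi> x)"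
    by (simp add: grad_inner_2 mult.commute)
  show "C_k 1 (\<lambda>x. grad \<phi> x \<bullet> d)"
    unfolding eq by (intro C_k_1_lincomb test_functionsD(1)[OF P])
  have "{x. grad \<phi> x \<bullet> d \<noteq> 0} \<subseteq> {x. pd 1 \<phi> x \<noteq> 0} \<union> {x. pd 2 \<phi> x \<noteq> 0}"
    by (auto simp: grad_inner_2)
  then show "bounded {x. grad \<phi> x \<bullet> d \<noteq> 0}"
    by (rule bounded_subset[rotated]) (simp only: bounded_Un test_functionsD(2)[OF P])
  show "x \<notin> \<Omega> \<Longrightarrow> grad \<phi> x \<bullet> d = 0"
    by (simp add: grad_inner_2 test_functionsD(3)[OF P])
  show "grad (\<lambda>x. grad \<phi> x \<bullet> d) x \<bullet> m
      = (d $ 1 * pd 1 (pd 1 \<phi>) x + d $ 2 * pd 1 (pd 2 \<phi>) x) * m $ 1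
        + (d $ 1 * pd 2 (pd 1 \<phi>) x + d $ 2 * pd 2 (pd 2 \<phi>) x) * m $ 2"
    unfolding eq grad_inner_2[of _ x m]
    by (simp only: C_k_1_lincomb(2)[OF test_functionsD(1)[OF P] test_functionsD(1)[OF P]])
qed

text \<open>Averaging the two orders of differentiation avoids the symmetry of the mixed derivatives.\<close>

lemma box_op_eq:
  assumes "\<phi> \<in> test_functions \<Omega>"
  shows "box_op \<phi> x = (1/2) * (grad (\<lambda>x. grad \<phi> x \<bullet> vector [1, 1]) x \<bullet> vector [1, -1])
    + (1/2) * (grad (\<lambda>x. grad \<phi> x \<bullet> vector [1, -1]) x \<bullet> vector [1, 1])"
  unfolding test_functions_grad(4)[OF assms] box_op_def by (simp add: field_simps)

lemma V4_subset_V: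
  assumes dom: "bounded_domain \<Omega>" and tri: "triangulation_of \<Omega> \<T>"
    and two: "\<And>T. T \<in> \<T> \<Longrightarrow> two_type_I_edges T"
  shows "V4 \<T> \<subseteq> V \<Omega>"
proof
  fix v assume "v \<in> V4 \<T>"
  then obtain p where p: "\<And>T. T \<in> \<T> \<Longrightarrow> p T \<in> polys 4"
    and v: "\<And>T x. T \<in> \<T> \<Longrightarrow> x \<in> interior T \<Longrightarrow> v x = p T x"
    and dofs: "\<forall>T\<in>\<T>. \<forall>(x, l)\<in>Xi T. \<forall>T'\<in>\<T>. x \<in> T' \<longrightarrow> l (p T') = l (p T)"
    unfolding V4_def fe_space_def by auto
  have \<T>: "triangulation \<T>" "\<And>T. T \<in> \<T> \<Longrightarrow> 2 simplex T" and cover: "\<Union>\<T> = closure \<Omega>"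
    using tri unfolding triangulation_of_def by auto
  have \<Omega>: "open \<Omega>" "bounded \<Omega>" using dom unfolding bounded_domain_def by auto
  interpret mesh \<T>
  proof
    show "finite \<T>" using \<T>(1) unfolding triangulation_def by blast
    show "compact T" "convex T" if "T \<in> \<T>" for T
      using \<T>(2)[OF that] by (auto intro: compact_simplex convex_simplex)
    show "interior T \<inter> interior T' = {}" if "T \<in> \<T>" "T' \<in> \<T>" "T \<noteq> T'" for T T'
    proof -
      have f: "(T \<inter> T') face_of T" "(T \<inter> T') face_of T'"
        using \<T>(1) that unfolding triangulation_def by (metis Int_commute)+
      have "T \<inter> T' \<noteq> T \<or> T \<inter> T' \<noteq> T'" using that(3) by blast
      \<comment> \<open>The intersection is a proper face of at least one of the two triangles, and
        a proper face misses the interior.\<close>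
      then have "T \<inter> T' \<inter> interior T = {} \<or> T \<inter> T' \<inter> interior T' = {}"
        using face_of_disjoint_interior f by metis
      then show ?thesis using interior_subset[of T] interior_subset[of T'] by blast
    qed
  qed
  have sub: "\<Omega> \<subseteq> \<Union>\<T>" unfolding cover by (rule closure_subset)
  have borel: "\<Omega> \<in> sets borel" using \<Omega>(1) by simp
  have "\<exists>a. labelled T a" if "T \<in> \<T>" for T
    using labelled_exists[OF two[OF that]] by blast
  then obtain lab where lab: "\<And>T. T \<in> \<T> \<Longrightarrow> labelled T (lab T)" by metis
  define A where "A = (\<Union>T\<in>\<T>. lab T ` {1..3})"
  have "finite A" unfolding A_def using fin by auto
  have match: "dofs_match (lab T) T' (p T) (p T')" if "T \<in> \<T>" "T' \<in> \<T>" for T T'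
    unfolding dofs_match_def
  proof (intro ballI, clarify)
    fix x l assume x: "(x, l) \<in> dofs4 (lab T)" "x \<in> T'"
    then have "(x, l) \<in> Xi T" unfolding Xi_def using lab[OF that(1)] by auto
    from bspec[OF bspec[OF dofs that(1)] this] show "l (p T') = l (p T)" using that(2) x(2) by simp
  qed
  \<comment> \<open>Here \<open>n\<close> has two roles: normal of the excluded lines, and, if it is
    diagonal, direction of the matching derivative. The values match for every \<open>n\<close>, as
    required for derivatives along the axes.\<close>
  have edge: "p T z = p T' z" "n \<noteq> 0 \<Longrightarrow> n $ 2 = n $ 1 \<or> n $ 2 = - (n $ 1) \<Longrightarrow> grad (p T) z \<bullet> n = grad (p T') z \<bullet> n"
    if T: "T \<in> \<T>" "T' \<in> \<T>" and z: "z \<in> T" "z \<in> T'" "z \<notin> vertex_lines A n" for T T' z n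
  proof -
    have "p T' z = p T z \<and> (n \<noteq> 0 \<longrightarrow> n $ 2 = n $ 1 \<or> n $ 2 = - (n $ 1) \<longrightarrow> grad (p T') z \<bullet> n = grad (p T) z \<bullet> n)"
    proof (cases "T = T'")
      case False
      have nv: "n \<bullet> z \<noteq> n \<bullet> lab T k" if "k \<in> {1..3}" for k
        using z(3) T(1) that unfolding vertex_lines_def A_def by auto
      then have "z \<notin> lab T ` {1..3}" by blast
      moreover have "triangle_with T (lab T)" using lab[OF T(1)] unfolding labelled_def by blast
      ultimately obtain i j t where ij: "i \<in> {1..2}" "j \<in> {2..3}" "i \<noteq> j"
        and seg: "closed_segment (lab T i) (lab T j) \<subseteq> T'" and zt: "z = lab T i + t *\<^sub>R (lab T j - lab T i)"
        using common_edge[OF \<T> T False _ z(1,2)] by metis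
      note E = edge_matching[OF lab[OF T(1)] p[OF T(1)] p[OF T(2)] match[OF T] ij seg zt]
      have "n \<bullet> z \<noteq> n \<bullet> lab T i" using ij by (intro nv) auto
      then show ?thesis using E type_I_matching[OF _ _ _ _ zt] by metis
    qed simp
    then show "p T z = p T' z" "n \<noteq> 0 \<Longrightarrow> n $ 2 = n $ 1 \<or> n $ 2 = - (n $ 1) \<Longrightarrow> grad (p T) z \<bullet> n = grad (p T') z \<bullet> n"
      by simp_all
  qed
  have p1: "(\<lambda>x. grad (p T) x \<bullet> d) \<in> polys 3" if "T \<in> \<T>" for T d
    using polys_grad[of "p T" 3 d] p[OF that] by simp
  have p2: "(\<lambda>x. grad (\<lambda>x. grad (p T) x \<bullet> d) x \<bullet> m) \<in> polys 2" if "T \<in> \<T>" for T d m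
    using polys_grad[of "\<lambda>x. grad (p T) x \<bullet> d" 2 m] p1[OF that] by simp
  have outside: "x \<notin> \<Union>\<T> \<Longrightarrow> x \<notin> \<Omega>" for x using sub by blast
  have parts1: "(\<integral>x. pw \<T> p x * (grad \<phi> x \<bullet> d) \<partial>lborel) = - (\<integral>x. pw \<T> (\<lambda>T x. grad (p T) x \<bullet> d) x * \<phi> x \<partial>lborel)"
    if "C_k 1 \<phi>" "bounded {x. \<phi> x \<noteq> 0}" "\<And>x. x \<notin> \<Omega> \<Longrightarrow> \<phi> x = 0" and n: "n \<noteq> 0" "n \<bullet> d = 0" for \<phi> d n
  proof (rule integral_by_parts[OF polys_C_k_1 negligible_vertex_lines[OF \<open>finite A\<close> n(1)] vertex_lines_invariant[OF _ n(2)]])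
    show "p T z = p T' z" if "T \<in> \<T>" "T' \<in> \<T>" "z \<in> T" "z \<in> T'" "z \<notin> vertex_lines A n" for T T' z
      using that by (rule edge(1))
  qed (use that p outside in auto)
  \<comment> \<open>The first integration by parts moves \<open>m\<close> and excludes lines with
    normal \<open>d\<close>; the second moves \<open>d\<close> and excludes lines with normal
    \<open>m\<close>, off which the derivatives along \<open>m\<close> match. The signs cancel, and
    the order of differentiation is reversed.\<close>
  have parts2: "(\<integral>x. pw \<T> p x * (grad (\<lambda>x. grad \<phi> x \<bullet> d) x \<bullet> m) \<partial>lborel)
      = (\<integral>x. pw \<T> (\<lambda>T x. grad (\<lambda>x. grad (p T) x \<bullet> m) x \<bullet> d) x * \<phi> x \<partial>lborel)"
    if \<phi>: "\<phi> \<in> test_functions \<Omega>" and m: "m \<noteq> 0" "d \<noteq> 0" "m \<bullet> d = 0" "m $ 2 = m $ 1 \<or> m $ 2 = - (m $ 1)" for \<phi> d m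
  proof -
    have "(\<integral>x. pw \<T> p x * (grad (\<lambda>x. grad \<phi> x \<bullet> d) x \<bullet> m) \<partial>lborel)
      = - (\<integral>x. pw \<T> (\<lambda>T x. grad (p T) x \<bullet> m) x * (grad \<phi> x \<bullet> d) \<partial>lborel)"
      using m test_functions_grad[OF \<phi>] by (intro parts1[where n = d]) (auto simp: inner_commute)
    also have "\<dots> = (\<integral>x. pw \<T> (\<lambda>T x. grad (\<lambda>x. grad (p T) x \<bullet> m) x \<bullet> d) x * \<phi> x \<partial>lborel)"
    proof (subst integral_by_parts[OF polys_C_k_1 negligible_vertex_lines[OF \<open>finite A\<close> m(1)] vertex_lines_invariant[OF _ m(3)]])
      show "grad (p T) z \<bullet> m = grad (p T') z \<bullet> m"
        if "T \<in> \<T>" "T' \<in> \<T>" "z \<in> T" "z \<in> T'" "z \<notin> vertex_lines A m" for T T' z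
        using that m(1,4) by (rule edge(2))
    qed (use p1 outside test_functionsD[OF \<phi>] in auto)
    finally show ?thesis .
  qed
  have "v \<in> L2 \<Omega>"
    using borel sub v polys_continuous[OF p] by (rule pw_L2)
  moreover have "\<exists>g\<in>L2 \<Omega>. has_weak_pd \<Omega> i v g" for i
  proof -
    define g where "g = pw \<T> (\<lambda>T x. grad (p T) x \<bullet> axis i 1)"
    have g: "g x = grad (p T) x \<bullet> axis i 1" if "T \<in> \<T>" "x \<in> interior T" for T x
      unfolding g_def using that by (rule pw_interior)
    have "g \<in> L2 \<Omega>"
      using borel sub g polys_continuous[OF p1] by (rule pw_L2)
    moreover have "has_weak_pd \<Omega> i v g"
      unfolding has_weak_pd_def
    proof
      \<comment> \<open>Differentiation runs along one axis, so the unit vector of the other axis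
        serves as the normal \<open>n\<close> of the excluded lines.\<close>
      fix \<phi> assume \<phi>: "\<phi> \<in> test_functions \<Omega>"
      obtain n :: "real^2" where n: "n \<noteq> 0" "n \<bullet> axis i 1 = 0"
      proof -
        obtain k :: 2 where "k \<noteq> i" using exhaust_2 by (metis one_neq_zero zero_neq_one num1_eq_iff)
        then show thesis by (intro that[of "axis k 1"]) (auto simp: inner_axis_axis axis_eq_0_iff)
      qed
      have "integral\<^sup>L (lebesgue_on \<Omega>) (\<lambda>x. v x * pd i \<phi> x) = (\<integral>x. pw \<T> p x * pd i \<phi> x \<partial>lborel)"
        using borel sub v polys_continuous[OF p] C_k_1_continuous[OF test_functionsD(1)[OF test_functions_pd[OF \<phi>]]]
          test_functionsD(3)[OF test_functions_pd[OF \<phi>]]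
        by (rule integral_lebesgue_on_pw)
      also have "\<dots> = - (\<integral>x. g x * \<phi> x \<partial>lborel)"
        using parts1[OF test_functionsD[OF \<phi>] n] unfolding g_def grad_inner_axis .
      also have "(\<integral>x. g x * \<phi> x \<partial>lborel) = integral\<^sup>L (lebesgue_on \<Omega>) (\<lambda>x. g x * \<phi> x)"
        unfolding g_def
        using borel sub g[unfolded g_def] polys_continuous[OF p1] C_k_1_continuous[OF test_functionsD(1)[OF \<phi>]]
          test_functionsD(3)[OF \<phi>]
        by (rule integral_lebesgue_on_pw[symmetric])
      finally show "integral\<^sup>L (lebesgue_on \<Omega>) (\<lambda>x. v x * pd i \<phi> x)
        = - integral\<^sup>L (lebesgue_on \<Omega>) (\<lambda>x. g x * \<phi> x)" .
    qed
    ultimately show ?thesis by blast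
  qed
  moreover have "\<exists>w\<in>L2 \<Omega>. has_weak_box \<Omega> v w"
  proof -
    define d m :: "real^2" where "d = vector [1, 1]" and "m = vector [1, -1]"
    have dm: "m \<noteq> 0" "d \<noteq> 0" "m \<bullet> d = 0" "d \<bullet> m = 0"
      "m $ 2 = m $ 1 \<or> m $ 2 = - (m $ 1)" "d $ 2 = d $ 1 \<or> d $ 2 = - (d $ 1)"
      by (auto simp: d_def m_def inner_2 vec_eq_iff forall_2)
    \<comment> \<open>Both orders of differentiation are kept, with the weights from
      \<open>box_op_eq\<close>. Since integration by parts reverses the order, \<open>B1\<close>
      will be paired with \<open>h1\<close>, where \<open>d\<close> is applied first, and
      \<open>B2\<close> with \<open>h2\<close>.\<close>
    define B1 where "B1 T x = grad (\<lambda>x. grad (p T) x \<bullet> m) x \<bullet> d" for T x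
    define B2 where "B2 T x = grad (\<lambda>x. grad (p T) x \<bullet> d) x \<bullet> m" for T x
    define B where "B T x = (1/2) * B1 T x + (1/2) * B2 T x" for T x
    have B12: "continuous_on UNIV (B1 T)" "continuous_on UNIV (B2 T)" if "T \<in> \<T>" for T
      using polys_continuous[OF p2[OF that]] unfolding B1_def[abs_def] B2_def[abs_def] by auto
    have B: "continuous_on UNIV (B T)" if "T \<in> \<T>" for T
      unfolding B_def[abs_def] using B12[OF that] by (intro continuous_intros)
    define w where "w = pw \<T> B"
    have w: "w x = B T x" if "T \<in> \<T>" "x \<in> interior T" for T x
      unfolding w_def using that by (rule pw_interior)
    have "w \<in> L2 \<Omega>"
      using borel sub w B by (rule pw_L2)
    moreover have "has_weak_box \<Omega> v w"
      unfolding has_weak_box_def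
    proof
      fix \<phi> assume \<phi>: "\<phi> \<in> test_functions \<Omega>"
      define h1 where "h1 x = grad (\<lambda>x. grad \<phi> x \<bullet> d) x \<bullet> m" for x
      define h2 where "h2 x = grad (\<lambda>x. grad \<phi> x \<bullet> m) x \<bullet> d" for x
      have box: "box_op \<phi> = (\<lambda>x. (1/2) * h1 x + (1/2) * h2 x)"
        using box_op_eq[OF \<phi>] unfolding h1_def h2_def d_def m_def by blast
      have h12: "continuous_on UNIV h1" "continuous_on UNIV h2"
        unfolding h1_def[abs_def] h2_def[abs_def]
        by (intro C_k_1_grad_continuous test_functions_grad(1)[OF \<phi>])+
      have box_cont: "continuous_on UNIV (box_op \<phi>)"
        unfolding box using h12 by (intro continuous_intros)
      have box_0: "box_op \<phi> x = 0" if "x \<notin> \<Omega>" for x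
        unfolding box_op_def using test_functionsD(3)[OF test_functions_pd[OF test_functions_pd[OF \<phi>]] that] by simp
      have \<phi>c: "continuous_on UNIV \<phi>" by (rule C_k_1_continuous[OF test_functionsD(1)[OF \<phi>]])
      have i: "integrable lborel (\<lambda>x. pw \<T> p x * h1 x)" "integrable lborel (\<lambda>x. pw \<T> p x * h2 x)"
        "integrable lborel (\<lambda>x. pw \<T> B1 x * \<phi> x)" "integrable lborel (\<lambda>x. pw \<T> B2 x * \<phi> x)"
        by (intro pw_mult_integrable polys_continuous[OF p] h12 B12 \<phi>c; assumption)+
      have "integral\<^sup>L (lebesgue_on \<Omega>) (\<lambda>x. v x * box_op \<phi> x) = (\<integral>x. pw \<T> p x * box_op \<phi> x \<partial>lborel)"
        using borel sub v polys_continuous[OF p] box_cont box_0 by (rule integral_lebesgue_on_pw)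
      also have "\<dots> = (\<integral>x. (1/2) * (pw \<T> p x * h1 x) + (1/2) * (pw \<T> p x * h2 x) \<partial>lborel)"
        unfolding box by (simp add: algebra_simps)
      also have "\<dots> = (1/2) * (\<integral>x. pw \<T> p x * h1 x \<partial>lborel) + (1/2) * (\<integral>x. pw \<T> p x * h2 x \<partial>lborel)"
        using i by (subst Bochner_Integration.integral_add) auto
      also have "\<dots> = (1/2) * (\<integral>x. pw \<T> B1 x * \<phi> x \<partial>lborel) + (1/2) * (\<integral>x. pw \<T> B2 x * \<phi> x \<partial>lborel)"
        using parts2[OF \<phi> dm(1,2,3,5)] parts2[OF \<phi> dm(2,1,4,6)]
        unfolding h1_def h2_def B1_def[abs_def] B2_def[abs_def] by simp
      also have "\<dots> = (\<integral>x. (1/2) * (pw \<T> B1 x * \<phi> x) + (1/2) * (pw \<T> B2 x * \<phi> x) \<partial>lborel)"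
        using i by (subst Bochner_Integration.integral_add) auto
      also have "\<dots> = (\<integral>x. w x * \<phi> x \<partial>lborel)"
        unfolding w_def B_def[abs_def] pw_add pw_cmult by (simp add: algebra_simps)
      also have "\<dots> = integral\<^sup>L (lebesgue_on \<Omega>) (\<lambda>x. w x * \<phi> x)"
        unfolding w_def using borel sub w[unfolded w_def] B \<phi>c test_functionsD(3)[OF \<phi>]
        by (rule integral_lebesgue_on_pw[symmetric])
      finally show "integral\<^sup>L (lebesgue_on \<Omega>) (\<lambda>x. v x * box_op \<phi> x)
        = integral\<^sup>L (lebesgue_on \<Omega>) (\<lambda>x. w x * \<phi> x)" .
    qed
    ultimately show ?thesis by blast
  qed
  ultimately show "v \<in> V \<Omega>" unfolding V_def H1_def by blast
qed

theorem theorem3p9: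
  fixes \<Omega> :: "(real^2) set" and H :: "real set"
    and \<T> :: "real \<Rightarrow> (real^2) set set" and h :: real
  assumes "bounded_domain \<Omega>"
    and "\<And>h. h \<in> H \<Longrightarrow> triangulation_of \<Omega> (\<T> h)"
    and "quasi_uniform H \<T>"
    and "\<And>h T. h \<in> H \<Longrightarrow> T \<in> \<T> h \<Longrightarrow> two_type_I_edges T"
    and "h \<in> H"
  shows "V4 (\<T> h) \<subseteq> V \<Omega>"
proof (rule V4_subset_V)
  show "bounded_domain \<Omega>" by fact
  show "triangulation_of \<Omega> (\<T> h)" using assms(2,5) by blast
  show "two_type_I_edges T" if "T \<in> \<T> h" for T using assms(4,5) that by blast
qed

end
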